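(* For $n\geq 1$, consider $(\mu_{n},\nu_{n})\in\mathcal{P}(\mathsf{X})\times\mathcal{P}(\mathsf{Y})$, $R_{n}\in\mathcal{P}(\mathsf{X}\times\mathsf{Y})$ and $\pi_{n}\in\Pi(\mu_{n},\nu_{n})$. Let $(\pi_{n},R_{n})$ be cyclically invariant and suppose that $\mu_{n},\nu_{n},R_{n}$ converge weakly to some limits $\mu,\nu,R$, where $R\sim P:=\mu\otimes\nu$. Writing $P_{n}:=\mu_{n}\otimes\nu_{n}$, suppose also that for some versions $\frac{dR_{n}}{dP_{n}},\frac{dR}{dP}: \mathsf{X}\times\mathsf{Y}\to (0,\infty)$ of the respective densities and some constants $\alpha_{n}>0$, it holds that for any fixed $z\in\operatorname{spt} R$, $$\frac{dR_{n}}{dP_{n}}(z')=[1+o(1)]\,\alpha_{n}\, \frac{dR}{dP}(z),$$ where $o(1)$ stands for a function $\phi_{z}(z',n)$ that tends to $0$ as $d(z',z)+1/n\to0$. Then $\pi_{n}$ converges weakly to a limit $\pi\in\Pi(\mu,\nu)$ with $\pi\sim R$, and $(\pi,R)$ is cyclically invariant.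
   Context: $(\mathsf{X},d)$ and $(\mathsf{Y},d)$ are complete separable metric spaces; $\mathsf{X}\times\mathsf{Y}$ carries the metric $d((x,y),(x',y'))=\max\{d(x,x'),d(y,y')\}$. $\mathcal{P}(\cdot)$ denotes the Borel probability measures with weak convergence (induced by bounded continuous functions); $\Pi(\mu,\nu)$ is the set of couplings, i.e. probability measures on $\mathsf{X}\times\mathsf{Y}$ with first marginal $\mu$ and second marginal $\nu$. $B_r(x)$ is the open ball of radius $r$ around $x$; $\sim$ denotes mutual absolute continuity; $\operatorname{spt}$ denotes the topological support of a measure. Standing assumption (differentiation of measures): given $\rho,\lambda\in\mathcal{P}(\mathsf{X})$ with $\rho\ll\lambda$, there exists $\mathsf{X}'\subset\mathsf{X}$ of full $\lambda$-measure such that $f(x):=\lim_{r\to0}\rho(B_r(x))/\lambda(B_r(x))$, $x\in\mathsf{X}'$, defines a version of the Radon–Nikodym density $d\rho/d\lambda$. The analogous property is assumed on $\mathsf{X}\times\mathsf{Y}$. Definition: for $\pi\in\Pi(\mu,\nu)$ and $R\in\mathcal{P}(\mathsf{X}\times\mathsf{Y})$, the pair $(\pi,R)$ is cyclically invariant if $\pi\sim R\sim\mu\otimes\nu$ and there exists a version $d\pi/dR:\mathsf{X}\times\mathsf{Y}\to(0,\infty)$ of the relative density satisfying $$\prod_{i=1}^{k} \frac{d\pi}{dR}(x_{i},y_{i})=\prod_{i=1}^{k} \frac{d\pi}{dR}(x_{i},y_{i+1})$$ for all $k\in\mathbb{N}$ and $(x_i,y_i)_{i=1}^k\subset\mathsf{X}\times\mathsf{Y}$,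 where $y_{k+1}:=y_1$. (For $(\pi_n,R_n)$ the marginals are $\mu_n,\nu_n$.) *)

theory Defs
  imports "HOL-Probability.Probability"
begin

text \<open>
  The two spaces are types of class \<^class>\<open>polish_space\<close> (complete separable metric spaces), and
  their Borel probability measures are the elements of \<open>space (prob_algebra borel)\<close>.
  Product measures are built with \<open>\<Otimes>\<^sub>M\<close>; by \<open>borel_prod\<close> they live on the Borel sigma-algebra of
  the product type.
\<close>

abbreviation borel_probs :: "'a::topological_space measure set" where
  "borel_probs \<equiv> space (prob_algebra borel)"

text \<open>
  The instance metric of the product type is the Euclidean combination of the two metrics, so the
  maximum metric has to be introduced separately. Both induce the product topology, but they have
  different balls, which matters for the differentiation of measures.
\<close>

definition max_dist :: "'a::metric_space \<times> 'b::metric_space \<Rightarrow> 'a \<times> 'b \<Rightarrow> real" where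
  "max_dist z z' = max (dist (fst z) (fst z')) (dist (snd z) (snd z'))"

definition weakly_converges ::
    "(nat \<Rightarrow> 'a::topological_space measure) \<Rightarrow> 'a measure \<Rightarrow> bool" where
  "weakly_converges M N \<longleftrightarrow>
     (\<forall>f :: 'a \<Rightarrow> real. continuous_on UNIV f \<and> bounded (range f) \<longrightarrow>
        (\<lambda>n. \<integral>x. f x \<partial>M n) \<longlonglongrightarrow> (\<integral>x. f x \<partial>N))"

definition couplings :: "'a::topological_space measure \<Rightarrow> 'b::topological_space measure
    \<Rightarrow> ('a \<times> 'b) measure set" where
  "couplings \<mu> \<nu> =
     {\<pi> \<in> borel_probs. distr \<pi> borel fst = \<mu> \<and> distr \<pi> borel snd = \<nu>}"

definition spt :: "'a::topological_space measure \<Rightarrow> 'a set" where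
  "spt M = {x. \<forall>U. open U \<longrightarrow> x \<in> U \<longrightarrow> 0 < emeasure M U}"

definition mutually_ac :: "'a measure \<Rightarrow> 'a measure \<Rightarrow> bool" where
  "mutually_ac M N \<longleftrightarrow> absolutely_continuous M N \<and> absolutely_continuous N M"

text \<open>\<open>f\<close> is a version of the density \<open>dN/dM\<close> with values in \<open>(0,\<infinity>)\<close> at every point.\<close>

definition positive_density ::
    "'a::topological_space measure \<Rightarrow> 'a measure \<Rightarrow> ('a \<Rightarrow> real) \<Rightarrow> bool" where
  "positive_density N M f \<longleftrightarrow>
     f \<in> borel_measurable borel \<and> (\<forall>z. 0 < f z) \<and> N = density M (\<lambda>z. ennreal (f z))"

text \<open>
  Differentiation of measures along the balls of the metric \<open>d\<close>. Note the argument order of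
  \<^const>\<open>absolutely_continuous\<close>: the dominating measure comes first. The convention \<open>a / 0 = 0\<close> only
  concerns points outside the support of \<open>l\<close>, which form an \<open>l\<close>-null set in a separable space.
\<close>

definition differentiation_of_measures :: "('a::topological_space \<Rightarrow> 'a \<Rightarrow> real) \<Rightarrow> bool" where
  "differentiation_of_measures d \<longleftrightarrow>
     (\<forall>\<rho> \<in> borel_probs. \<forall>l \<in> borel_probs. absolutely_continuous l \<rho> \<longrightarrow>
        (\<exists>X' \<in> sets borel. measure l X' = 1 \<and>
          (\<exists>f :: 'a \<Rightarrow> real. f \<in> borel_measurable borel \<and>
             (\<forall>x\<in>X'. ((\<lambda>r. measure \<rho> {y. d x y < r} / measure l {y. d x y < r})
                \<longlongrightarrow> f x) (at_right 0)) \<and>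
             \<rho> = density l (\<lambda>x. ennreal (f x)))))"

text \<open>
  The cycles are the points \<open>(x 1, y 1), \<dots>, (x k, y k)\<close>; the value \<open>y (Suc k)\<close> is the
  wrap-around \<open>y 1\<close>.
\<close>

definition cyclically_invariant ::
    "'a::topological_space measure \<Rightarrow> 'b::topological_space measure
      \<Rightarrow> ('a \<times> 'b) measure \<Rightarrow> ('a \<times> 'b) measure \<Rightarrow> bool" where
  "cyclically_invariant \<mu> \<nu> \<pi> R \<longleftrightarrow>
     \<pi> \<in> couplings \<mu> \<nu> \<and> R \<in> borel_probs \<and>
     mutually_ac \<pi> R \<and> mutually_ac R (\<mu> \<Otimes>\<^sub>M \<nu>) \<and>
     (\<exists>g. positive_density \<pi> R g \<and>
        (\<forall>(k::nat) (x :: nat \<Rightarrow> 'a) (y :: nat \<Rightarrow> 'b). y (Suc k) = y 1 \<longrightarrow>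
           (\<Prod>i=1..k. g (x i, y i)) = (\<Prod>i=1..k. g (x i, y (Suc i)))))"

end

theory Submission
  imports Defs
begin

text \<open>
  Along every filter below \<open>sequentially\<close> the couplings \<open>\<pi>n\<close> have a limit point, every limit point is
  a coupling of \<open>\<mu>\<close> and \<open>\<nu>\<close> whose density with respect to \<open>R\<close> is a product \<open>u(x) v(y)\<close>, and there is only
  one such coupling. Hence the whole sequence converges, and a product density is cyclically invariant.

  Limit points exist (\<open>coupling_limit\<close>) because the marginals converge to tight measures. Filters take
  the place of subsequences: Tychonoff's theorem provides a filter along which \<open>\<pi>n U\<close> converges for
  all sets \<open>U\<close> at once, and a measure is built from these limits on the open sets
  (\<open>borel_measure_below_open_set_function\<close>).

  The heart of the matter is that cyclic invariance survives in the limit, although densities do not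
  pass to weak limits. Let \<open>S\<close> exchange the second coordinates of two points, so that
  \<open>S ((x, y), (x', y')) = ((x, y'), (x', y))\<close>. It preserves \<open>P \<otimes> P\<close> for \<open>P = \<mu>n \<otimes> \<nu>n\<close>. Write
  \<open>d\<pi>n/dP = g r\<close> with \<open>g = d\<pi>n/dRn\<close> and \<open>r = dRn/dP\<close>, and \<open>H (z, z') = r z r z'\<close>. Cyclic invariance for \<open>k = 2\<close>
  says that \<open>g z g z'\<close> is \<open>S\<close>-invariant; therefore multiplying \<open>\<pi>n \<otimes> \<pi>n\<close> by the weight
  \<open>w = (H \<circ> S) / (H + H \<circ> S)\<close> gives an \<open>S\<close>-invariant measure, of density \<open>(g z g z') H (H \<circ> S) / (H + H \<circ> S)\<close>
  (\<open>exchange_weight_integral_invariant\<close>). The weight is bounded and insensitive to the constants \<open>\<alpha> n\<close>,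
  and the assumed asymptotics make it converge continuously on the support, which is exactly what
  allows a varying integrand in a weak limit (\<open>integral_tendsto_continuous_convergence\<close>). So
  \<open>w (\<pi> \<otimes> \<pi>)\<close> is \<open>S\<close>-invariant for every limit point \<open>\<pi>\<close>.

  Invariance of this positive multiple of \<open>\<pi> \<otimes> \<pi>\<close> has two consequences
  (\<open>product_density_of_exchange_invariance\<close>). The first point of a pair has law \<open>\<pi>\<close> before the exchange and
  \<open>\<mu> \<otimes> \<nu>\<close> after it, so these two are equivalent. And the density \<open>q = d\<pi>/dR\<close> satisfies
  \<open>q (x, y) q (x', y') = q (x, y') q (x', y)\<close> almost everywhere; freezing \<open>(x', y')\<close> at a good point
  turns this into a product density. Uniqueness (\<open>coupling_product_density_unique\<close>) follows by
  testing two such couplings against one bounded function of the form \<open>f(x) + h(y)\<close>.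
\<close>

section \<open>Measures from set functions on open sets\<close>

lemma compact_separation:
  fixes K L :: "'a::metric_space set"
  assumes "compact K" "compact L" "K \<inter> L = {}"
  obtains A B where "open A" "open B" "K \<subseteq> A" "L \<subseteq> B" "A \<inter> B = {}"
proof -
  have "\<And>A B. open A \<Longrightarrow> open B \<Longrightarrow> K \<subseteq> A \<Longrightarrow> L \<subseteq> B \<Longrightarrow> disjnt A B \<Longrightarrow> thesis"
    using that by (simp add: disjnt_def)
  then show thesis
    using Hausdorff_space_compact_separation[OF Hausdorff_space_euclidean, of K L thesis] assms
    by (simp add: disjnt_def)
qed

text \<open>
  The parts of \<open>K\<close> outside \<open>U\<close> and outside \<open>V\<close> are disjoint compact sets; removing disjoint open
  neighbourhoods of them from \<open>K\<close> leaves the two pieces.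
\<close>

lemma compact_split_open_cover:
  fixes K :: "'a::metric_space set"
  assumes "compact K" "open U" "open V" "K \<subseteq> U \<union> V"
  obtains K1 K2 where "compact K1" "compact K2" "K1 \<subseteq> U" "K2 \<subseteq> V" "K = K1 \<union> K2"
proof -
  have "compact (K - U)" "compact (K - V)" "(K - U) \<inter> (K - V) = {}"
    using assms by (auto intro: compact_diff)
  then obtain A B where "open A" "open B" "K - U \<subseteq> A" "K - V \<subseteq> B" "A \<inter> B = {}"
    by (rule compact_separation)
  then have "compact (K - A)" "compact (K - B)" "K - A \<subseteq> U" "K - B \<subseteq> V" "K = (K - A) \<union> (K - B)"
    using assms by (auto intro: compact_diff)
  then show thesis using that by blast
qed

text \<open>
  A limit of probability measures along a filter is only finitely additive. Its outer regularisation
  on compact sets, \<open>l K\<close>, is a content: it remains additive on disjoint compact sets, since these have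
  disjoint open neighbourhoods. Extending \<open>l\<close> to open sets from inside (\<open>t\<close>) and then to all sets from
  outside (\<open>m\<close>) restores countable subadditivity, because a compact subset of a countable union of
  open sets splits into finitely many compact pieces. Caratheodory's theorem then yields a measure.
  It lies below \<open>a\<close> on open sets, which is the portmanteau inequality; tightness is what keeps its
  total mass equal to 1.
\<close>

lemma borel_measure_below_open_set_function:
  fixes a :: "'a::metric_space set \<Rightarrow> ennreal"
  assumes empty: "a {} = 0"
    and mono: "\<And>U V. open U \<Longrightarrow> open V \<Longrightarrow> U \<subseteq> V \<Longrightarrow> a U \<le> a V"
    and subadd: "\<And>U V. open U \<Longrightarrow> open V \<Longrightarrow> a (U \<union> V) \<le> a U + a V"
    and superadd: "\<And>U V. open U \<Longrightarrow> open V \<Longrightarrow> U \<inter> V = {} \<Longrightarrow> a U + a V \<le> a (U \<union> V)"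
    and total: "a UNIV \<le> 1"
    and tight: "\<And>e :: real. e > 0 \<Longrightarrow> \<exists>K. compact K \<and> (\<forall>U. open U \<and> K \<subseteq> U \<longrightarrow> 1 \<le> a U + ennreal e)"
  obtains M where "M \<in> borel_probs" "\<And>U. open U \<Longrightarrow> emeasure M U \<le> a U"
proof -
  define l where "l K = (INF U\<in>{U. open U \<and> K \<subseteq> U}. a U)" for K
  define t where "t U = (SUP K\<in>{K. compact K \<and> K \<subseteq> U}. l K)" for U
  define m where "m S = (INF U\<in>{U. open U \<and> S \<subseteq> U}. t U)" for S
  have l_le_a: "l K \<le> a U" if "open U" "K \<subseteq> U" for K U
    unfolding l_def using that by (auto intro: INF_lower)
  have l_le_t: "l K \<le> t U" if "compact K" "K \<subseteq> U" for K U
    unfolding t_def using that by (auto intro: SUP_upper)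
  have t_le_a: "t U \<le> a U" if "open U" for U
    unfolding t_def using that by (auto intro: SUP_least l_le_a)
  have t_mono: "t U \<le> t V" if "U \<subseteq> V" for U V
    unfolding t_def using that by (intro SUP_subset_mono) auto
  have m_le_t: "m S \<le> t U" if "open U" "S \<subseteq> U" for S U
    unfolding m_def using that by (auto intro: INF_lower)
  have m_open: "m U = t U" if "open U" for U
    using that m_le_t[of U U] unfolding m_def by (intro antisym INF_greatest) (auto intro: t_mono)
  have a_fin: "a U < top" if "open U" for U
    using mono[OF that open_UNIV] total by (meson ennreal_one_less_top le_less_trans subset_UNIV)
  have t_fin: "t U < top" if "open U" for U
    using t_le_a[OF that] a_fin[OF that] by simp
  have m_fin: "m S < top" for S
    using m_le_t[OF open_UNIV, of S] t_fin[OF open_UNIV] by simp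
  have l_fin: "l K < top" for K
    using l_le_a[OF open_UNIV, of K] a_fin[OF open_UNIV] by simp
  have l_approx: "\<exists>U. open U \<and> K \<subseteq> U \<and> a U \<le> l K + ennreal e" if "e > 0" for e :: real and K
  proof -
    have "l K < l K + ennreal e" using that l_fin[of K]
      by (metis ennreal_0 ennreal_less_zero_iff add.right_neutral ennreal_add_left_cancel_less
          infinity_ennreal_def less_irrefl)
    then obtain U where "open U" "K \<subseteq> U" "a U < l K + ennreal e"
      unfolding l_def INF_less_iff by auto
    then show ?thesis by (auto intro: less_imp_le)
  qed
  have t_approx: "\<exists>K. compact K \<and> K \<subseteq> U \<and> t U \<le> l K + ennreal e" if "e > 0" "open U" for e :: real and U
  proof (rule ccontr)
    assume *: "\<not> ?thesis"
    then have "l K + ennreal e \<le> t U" if "compact K" "K \<subseteq> U" for K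
      using that by (auto intro: less_imp_le simp: not_le)
    then have "(SUP K\<in>{K. compact K \<and> K \<subseteq> U}. l K + ennreal e) \<le> t U"
      by (auto intro: SUP_least)
    moreover have "(SUP K\<in>{K. compact K \<and> K \<subseteq> U}. l K + ennreal e) = t U + ennreal e"
      unfolding t_def by (rule ennreal_SUP_add_left) auto
    ultimately have "t U + ennreal e \<le> t U + 0" by simp
    then show False using t_fin[OF \<open>open U\<close>] \<open>e > 0\<close>
      by (simp add: ennreal_add_left_cancel_le)
  qed
  have m_approx: "\<exists>U. open U \<and> S \<subseteq> U \<and> t U \<le> m S + ennreal e" if "e > 0" for e :: real and S
  proof -
    have "m S < m S + ennreal e" using that m_fin[of S]
      by (metis ennreal_0 ennreal_less_zero_iff add.right_neutral ennreal_add_left_cancel_less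
          infinity_ennreal_def less_irrefl)
    then obtain U where "open U" "S \<subseteq> U" "t U < m S + ennreal e"
      unfolding m_def INF_less_iff by auto
    then show ?thesis by (auto intro: less_imp_le)
  qed
  have l_Un_disjoint: "l K + l L \<le> l (K \<union> L)" if KL: "compact K" "compact L" "K \<inter> L = {}" for K L
  proof -
    obtain A B where AB: "open A" "open B" "K \<subseteq> A" "L \<subseteq> B" "A \<inter> B = {}"
      by (rule compact_separation[OF KL])
    show ?thesis unfolding l_def[of "K \<union> L"]
    proof (rule INF_greatest, safe)
      fix W assume W: "open W" "K \<union> L \<subseteq> W"
      have "l K + l L \<le> a (W \<inter> A) + a (W \<inter> B)"
        using AB W by (intro add_mono l_le_a) auto
      also have "\<dots> \<le> a ((W \<inter> A) \<union> (W \<inter> B))"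
        using AB W by (intro superadd) auto
      also have "\<dots> \<le> a W"
        using AB W by (intro mono) auto
      finally show "l K + l L \<le> a W" .
    qed
  qed
  have l_Un: "l (K \<union> L) \<le> l K + l L" for K L
  proof (rule ennreal_le_epsilon)
    fix e :: real assume "0 < e"
    then have e2: "e / 2 > 0" by simp
    obtain U V where "open U" "K \<subseteq> U" "a U \<le> l K + ennreal (e/2)" "open V" "L \<subseteq> V" "a V \<le> l L + ennreal (e/2)"
      using l_approx[OF e2] by meson
    then have "l (K \<union> L) \<le> a (U \<union> V)" "a (U \<union> V) \<le> a U + a V"
      "a U + a V \<le> (l K + ennreal (e/2)) + (l L + ennreal (e/2))"
      by (auto intro!: l_le_a subadd add_mono)
    then have "l (K \<union> L) \<le> (l K + ennreal (e/2)) + (l L + ennreal (e/2))" by order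
    also have "\<dots> = l K + l L + (ennreal (e/2) + ennreal (e/2))" by (simp add: ac_simps)
    also have "ennreal (e/2) + ennreal (e/2) = ennreal e"
      using e2 by (subst ennreal_plus[symmetric]) auto
    finally show "l (K \<union> L) \<le> l K + l L + ennreal e" .
  qed
  have l_UN: "l K \<le> (\<Sum>i<n. t (U i))"
    if U: "\<And>i. open (U i)" and K: "compact K" "K \<subseteq> (\<Union>i<n. U i)"
    for K n and U :: "nat \<Rightarrow> 'a set"
    using K
  proof (induction n arbitrary: K)
    case 0
    then have "l K \<le> a {}" by (intro l_le_a) auto
    then show ?case using empty by simp
  next
    case (Suc n)
    have cover: "K \<subseteq> (\<Union>i<n. U i) \<union> U n" using Suc.prems(2) by (auto simp: lessThan_Suc)
    obtain K1 K2 where K: "compact K1" "compact K2" "K1 \<subseteq> (\<Union>i<n. U i)" "K2 \<subseteq> U n" "K = K1 \<union> K2"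
      by (rule compact_split_open_cover[OF Suc.prems(1), of "\<Union>i<n. U i" "U n"]) (use U cover in auto)
    then have "l K \<le> l K1 + l K2" using l_Un by simp
    also have "\<dots> \<le> (\<Sum>i<n. t (U i)) + t (U n)"
      using K by (intro add_mono Suc.IH l_le_t)
    finally show ?case by simp
  qed
  have t_UN: "t (\<Union>i. U i) \<le> (\<Sum>i. t (U i))" if U: "\<And>i. open (U i)" for U :: "nat \<Rightarrow> 'a set"
    unfolding t_def[of "\<Union>i. U i"]
  proof (rule SUP_least, safe)
    fix K assume K: "compact K" "K \<subseteq> (\<Union>i. U i)"
    obtain D where D: "finite D" "K \<subseteq> (\<Union>i\<in>D. U i)"
      by (rule compactE_image[OF K(1), of UNIV U]) (use U K(2) in auto)
    obtain n where "D \<subseteq> {..<n}" using finite_nat_iff_bounded[THEN iffD1, OF D(1)] by (elim exE)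
    then have "K \<subseteq> (\<Union>i<n. U i)" using D by blast
    then have "l K \<le> (\<Sum>i<n. t (U i))" by (rule l_UN[OF U K(1)])
    also have "\<dots> \<le> (\<Sum>i. t (U i))" by (rule sum_le_suminf) auto
    finally show "l K \<le> (\<Sum>i. t (U i))" .
  qed
  have m_countably_subadditive: "m (\<Union>i. A i) \<le> (\<Sum>i. m (A i))" for A :: "nat \<Rightarrow> 'a set"
  proof (rule ennreal_le_epsilon)
    fix e :: real assume "0 < e"
    have "\<exists>U. open U \<and> A i \<subseteq> U \<and> t U \<le> m (A i) + ennreal (e * (1/2) ^ Suc i)" for i
      by (rule m_approx) (use \<open>0 < e\<close> in simp)
    then obtain U where U: "\<And>i. open (U i)" "\<And>i. A i \<subseteq> U i"
      "\<And>i. t (U i) \<le> m (A i) + ennreal (e * (1/2) ^ Suc i)" by metis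
    have "m (\<Union>i. A i) \<le> t (\<Union>i. U i)" using U by (intro m_le_t) auto
    also have "\<dots> \<le> (\<Sum>i. t (U i))" using U by (intro t_UN)
    also have "\<dots> \<le> (\<Sum>i. m (A i) + ennreal (e * (1/2) ^ Suc i))"
      using U by (intro suminf_le) auto
    also have "\<dots> = (\<Sum>i. m (A i)) + (\<Sum>i. ennreal (e * (1/2) ^ Suc i))"
      by (rule suminf_add[symmetric]) auto
    also have "(\<Sum>i. ennreal (e * (1/2) ^ Suc i)) = ennreal (\<Sum>i. e * (1/2) ^ Suc i)"
      using \<open>0 < e\<close> by (intro suminf_ennreal2 summable_mult sums_summable[OF power_half_series]) auto
    also have "(\<Sum>i. e * (1/2) ^ Suc i) = e"
      using sums_mult[OF power_half_series, of e] by (simp add: sums_iff)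
    finally show "m (\<Union>i. A i) \<le> (\<Sum>i. m (A i)) + ennreal e" .
  qed
  have m_mono: "m S \<le> m T" if "S \<subseteq> T" for S T
    unfolding m_def using that by (intro INF_superset_mono) auto
  have m_empty: "m {} = 0"
    using m_open[of "{}"] t_le_a[of "{}"] empty by simp
  have m_Un: "m (S \<union> T) \<le> m S + m T" for S T
  proof -
    have "m (\<Union>i. binaryset S T i) \<le> (\<Sum>i. m (binaryset S T i))" by (rule m_countably_subadditive)
    then show ?thesis
      by (simp add: UN_binaryset_eq suminf_binaryset_eq m_empty)
  qed
  have outer: "outer_measure_space (Pow UNIV) m"
    unfolding outer_measure_space_def
    by (auto simp: positive_def increasing_def countably_subadditive_def m_empty m_mono m_countably_subadditive)
  interpret sigma_algebra "UNIV :: 'a set" "Pow UNIV" by (rule sigma_algebra_Pow)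
  define L where "L = lambda_system UNIV (Pow UNIV) m"
  have L: "measure_space UNIV L m" unfolding L_def by (rule caratheodory_lemma[OF outer])
  have open_L: "U \<in> L" if "open U" for U
  proof -
    have open_case: "m (V \<inter> U) + m (V - U) \<le> t V" if "open V" for V
    proof (rule ennreal_le_epsilon)
      fix e :: real assume "0 < e"
      then have e2: "e / 2 > 0" by simp
      obtain K where K: "compact K" "K \<subseteq> V \<inter> U" "t (V \<inter> U) \<le> l K + ennreal (e/2)"
        using t_approx[OF e2, of "V \<inter> U"] \<open>open U\<close> \<open>open V\<close> by auto
      have "open (V - K)" using K(1) \<open>open V\<close> by (simp add: compact_imp_closed open_Diff)
      then obtain K' where K': "compact K'" "K' \<subseteq> V - K" "t (V - K) \<le> l K' + ennreal (e/2)"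
        using t_approx[OF e2, of "V - K"] by auto
      have "m (V \<inter> U) + m (V - U) \<le> t (V \<inter> U) + t (V - K)"
        using \<open>open (V - K)\<close> \<open>open U\<close> \<open>open V\<close> K by (intro add_mono m_le_t) auto
      also have "\<dots> \<le> (l K + ennreal (e/2)) + (l K' + ennreal (e/2))"
        using K K' by (intro add_mono) auto
      also have "\<dots> = l K + l K' + (ennreal (e/2) + ennreal (e/2))" by (simp add: ac_simps)
      also have "ennreal (e/2) + ennreal (e/2) = ennreal e"
        using e2 by (subst ennreal_plus[symmetric]) auto
      also have "l K + l K' \<le> l (K \<union> K')" using K K' by (intro l_Un_disjoint) auto
      also have "l (K \<union> K') \<le> t V" using K K' by (intro l_le_t) auto
      finally show "m (V \<inter> U) + m (V - U) \<le> t V + ennreal e" by (simp add: add_right_mono)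
    qed
    have "m (S \<inter> U) + m (S - U) \<le> m S" for S
      unfolding m_def[of S]
    proof (rule INF_greatest, safe)
      fix V assume V: "open V" "S \<subseteq> V"
      have "m (S \<inter> U) + m (S - U) \<le> m (V \<inter> U) + m (V - U)"
        using V by (intro add_mono m_mono) auto
      then show "m (S \<inter> U) + m (S - U) \<le> t V" using open_case[OF V(1)] by order
    qed
    moreover have "m S \<le> m (S \<inter> U) + m (S - U)" for S
      using m_Un[of "S \<inter> U" "S - U"] by (simp add: Int_Diff_Un)
    ultimately show ?thesis
      unfolding L_def lambda_system_eq by (auto intro: antisym)
  qed
  interpret L: sigma_algebra "UNIV :: 'a set" L using L by (simp add: measure_space_def)
  have borel_L: "sets (borel :: 'a measure) \<subseteq> L"
    unfolding sets_borel using open_L by (auto intro!: L.sigma_sets_subset)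
  define M where "M = measure_of UNIV (sets (borel :: 'a measure)) m"
  have "countably_additive (sets (borel :: 'a measure)) m"
  proof (rule countably_additiveI)
    fix A :: "nat \<Rightarrow> 'a set"
    assume "range A \<subseteq> sets borel" "disjoint_family A" "(\<Union>i. A i) \<in> sets borel"
    moreover from this have "range A \<subseteq> L" "(\<Union>i. A i) \<in> L" using borel_L by blast+
    moreover have "countably_additive L m" using L by (simp add: measure_space_def)
    ultimately show "(\<Sum>i. m (A i)) = m (\<Union>i. A i)" unfolding countably_additive_def by blast
  qed
  then have "measure_space UNIV (sets (borel :: 'a measure)) m"
    using sets.sigma_algebra_axioms[of "borel :: 'a measure"] m_empty
    by (simp add: measure_space_def positive_def)
  then have emeasure_M: "emeasure M A = m A" if "A \<in> sets borel" for A
    unfolding M_def using that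
    by (intro emeasure_measure_of_sigma) (auto simp: measure_space_def)
  have sets_M: "sets M = sets borel" "space M = UNIV"
    unfolding M_def
    using sets.sigma_sets_eq[of "borel :: 'a measure"]
    by (auto simp: space_measure_of_conv sets_measure_of_conv)
  have "1 \<le> m UNIV"
  proof (rule ennreal_le_epsilon)
    fix e :: real assume "0 < e"
    then have e2: "e / 2 > 0" by simp
    obtain K where K: "compact K" "\<And>U. open U \<Longrightarrow> K \<subseteq> U \<Longrightarrow> 1 \<le> a U + ennreal (e/2)"
      using tight[OF e2] by blast
    obtain U where U: "open U" "K \<subseteq> U" "a U \<le> l K + ennreal (e/2)"
      using l_approx[OF e2] by blast
    have "1 \<le> a U + ennreal (e/2)" using K U by blast
    also have "\<dots> \<le> (l K + ennreal (e/2)) + ennreal (e/2)" using U by (intro add_mono) auto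
    also have "\<dots> = l K + ennreal e" using e2 by (simp add: add.assoc flip: ennreal_plus)
    also have "l K \<le> t UNIV" using K by (intro l_le_t) auto
    finally show "1 \<le> m UNIV + ennreal e" by (simp add: m_open add_right_mono)
  qed
  moreover have "m UNIV \<le> 1" using m_open[of UNIV] t_le_a[of UNIV] total by simp
  ultimately have "prob_space M"
    by (intro prob_spaceI) (auto simp: sets_M emeasure_M intro: antisym)
  then have "M \<in> borel_probs" using sets_M by (simp add: space_prob_algebra)
  moreover have "emeasure M U \<le> a U" if "open U" for U
    using that by (simp add: emeasure_M m_open t_le_a)
  ultimately show thesis using that by blast
qed

section \<open>Borel probability measures\<close>

lemma borel_probsD:
  assumes "N \<in> borel_probs"
  shows "prob_space N" "sets N = sets borel" "space N = UNIV"
  using assms sets_eq_imp_space_eq[of N borel] by (auto simp: space_prob_algebra)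

lemma borel_probsI: "prob_space N \<Longrightarrow> sets N = sets borel \<Longrightarrow> N \<in> borel_probs"
  by (simp add: space_prob_algebra)

lemma measurable_borel_probs: "N \<in> borel_probs \<Longrightarrow> measurable N K = measurable borel K"
  by (rule measurable_cong_sets[OF borel_probsD(2) refl])

lemma integrable_bounded_borel:
  fixes f :: "'a::topological_space \<Rightarrow> real"
  assumes "finite_measure N" "sets N = sets borel" "f \<in> borel_measurable borel" "\<And>x. \<bar>f x\<bar> \<le> B"
  shows "integrable N f"
proof -
  interpret finite_measure N by fact
  have "f \<in> borel_measurable N" using assms(3) by (simp add: measurable_cong_sets[OF assms(2) refl])
  then show ?thesis using assms(4) by (intro integrable_const_bound[where B=B]) auto
qed

lemma open_indicator_limit:
  fixes U :: "'a::metric_space set"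
  assumes "open U"
  shows "\<exists>f :: nat \<Rightarrow> 'a \<Rightarrow> real. (\<forall>k. continuous_on UNIV (f k)) \<and> (\<forall>k x. 0 \<le> f k x) \<and>
    (\<forall>k x. f k x \<le> indicator U x) \<and> (\<forall>x. (\<lambda>k. f k x) \<longlonglongrightarrow> indicator U x)"
proof (cases "U = UNIV")
  case True
  show ?thesis by (rule exI[of _ "\<lambda>_ _. 1"]) (auto simp: True)
next
  case False
  define f where "f k x = min 1 (real k * infdist x (- U))" for k x
  have out: "infdist x (- U) = 0" if "x \<notin> U" for x using that by simp
  have inn: "infdist x (- U) > 0" if "x \<in> U" for x
    using infdist_pos_not_in_closed[of "- U" x] assms False that by auto
  show ?thesis
  proof (intro exI[of _ f] conjI allI)
    fix k x
    show "continuous_on UNIV (f k)" unfolding f_def by (intro continuous_intros)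
    show "0 \<le> f k x" by (simp add: f_def infdist_nonneg)
    show "f k x \<le> indicator U x" by (auto simp: f_def indicator_def out)
    show "(\<lambda>k. f k x) \<longlonglongrightarrow> indicator U x"
    proof (cases "x \<in> U")
      case True
      obtain n :: nat where n: "1 < real n * infdist x (- U)"
        using inn[OF True] reals_Archimedean3 by blast
      have "f k x = 1" if "k \<ge> n" for k
      proof -
        have "real n * infdist x (- U) \<le> real k * infdist x (- U)"
          using that by (intro mult_right_mono) (auto simp: infdist_nonneg)
        then show ?thesis using n by (simp add: f_def)
      qed
      then have "eventually (\<lambda>k. f k x = 1) sequentially"
        by (auto simp: eventually_sequentially)
      then show ?thesis using True by (simp add: tendsto_eventually)
    next
      case False
      then show ?thesis by (simp add: f_def out)
    qed
  qed
qed

lemma integral_tendsto_measure_open: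
  fixes f :: "nat \<Rightarrow> 'a::metric_space \<Rightarrow> real"
  assumes N: "finite_measure N" "sets N = sets borel" and "open U"
    and f: "\<And>k. continuous_on UNIV (f k)" "\<And>k x. 0 \<le> f k x" "\<And>k x. f k x \<le> indicator U x"
      "\<And>x. (\<lambda>k. f k x) \<longlonglongrightarrow> indicator U x"
  shows "(\<lambda>k. \<integral>x. f k x \<partial>N) \<longlonglongrightarrow> measure N U"
proof -
  interpret finite_measure N by fact
  have meas: "f k \<in> borel_measurable N" for k
    using borel_measurable_continuous_onI[OF f(1)] by (simp add: measurable_cong_sets[OF N(2) refl])
  have ind: "indicator U \<in> borel_measurable N" "U \<in> sets N"
    using \<open>open U\<close> by (simp_all add: N(2) measurable_cong_sets[OF N(2) refl])
  have "f k x \<le> 1" for k x using order_trans[OF f(3) indicator_le_1] .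
  then have "(\<lambda>k. \<integral>x. f k x \<partial>N) \<longlonglongrightarrow> (\<integral>x. indicator U x \<partial>N)"
    using f(2,4) meas ind by (intro integral_dominated_convergence[where w="\<lambda>_. 1"]) auto
  then show ?thesis using ind sets.sets_into_space[OF ind(2)] by (simp add: Int_absorb2)
qed

text \<open>
  Open sets form a generating \<open>\<inter>\<close>-stable class, and their indicators are pointwise limits of bounded
  continuous functions.
\<close>

lemma finite_borel_measure_eqI:
  fixes M N :: "'a::metric_space measure"
  assumes M: "finite_measure M" "sets M = sets borel" and N: "finite_measure N" "sets N = sets borel"
    and eq: "\<And>f :: 'a \<Rightarrow> real. continuous_on UNIV f \<Longrightarrow> (\<And>x. 0 \<le> f x) \<Longrightarrow> (\<And>x. f x \<le> 1) \<Longrightarrow>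
      (\<integral>x. f x \<partial>M) = (\<integral>x. f x \<partial>N)"
  shows "M = N"
proof -
  interpret M: finite_measure M by fact
  interpret N: finite_measure N by fact
  show ?thesis
  proof (rule measure_eqI_generator_eq[where E="{U. open U}" and \<Omega>=UNIV and A="\<lambda>_. UNIV"])
    fix U :: "'a set" assume "U \<in> {U. open U}"
    then have "open U" by simp
    obtain f :: "nat \<Rightarrow> 'a \<Rightarrow> real" where f: "\<And>k. continuous_on UNIV (f k)" "\<And>k x. 0 \<le> f k x"
      "\<And>k x. f k x \<le> indicator U x" "\<And>x. (\<lambda>k. f k x) \<longlonglongrightarrow> indicator U x"
      using open_indicator_limit[OF \<open>open U\<close>] by blast
    have "f k x \<le> 1" for k x using order_trans[OF f(3) indicator_le_1] .
    then have "(\<integral>x. f k x \<partial>M) = (\<integral>x. f k x \<partial>N)" for k using f by (intro eq)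
    then have "measure M U = measure N U"
      using integral_tendsto_measure_open[OF M \<open>open U\<close> f] integral_tendsto_measure_open[OF N \<open>open U\<close> f]
      by (simp add: LIMSEQ_unique)
    then show "emeasure M U = emeasure N U"
      by (simp add: M.emeasure_eq_measure N.emeasure_eq_measure)
  qed (use M N in \<open>auto simp: Int_stable_def borel_def sets_measure_of_conv\<close>)
qed

lemma sets_pair_borel:
  "sets ((borel :: 'a measure) \<Otimes>\<^sub>M (borel :: 'b measure) :: ('a::second_countable_topology \<times> 'b::second_countable_topology) measure) = sets borel"
  by (simp only: borel_prod)

lemma pair_measure_in_borel_probs:
  fixes M :: "'a::second_countable_topology measure" and N :: "'b::second_countable_topology measure"
  assumes "M \<in> borel_probs" "N \<in> borel_probs"
  shows "M \<Otimes>\<^sub>M N \<in> borel_probs"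
proof (rule borel_probsI)
  interpret M: prob_space M by (rule borel_probsD[OF assms(1)])
  interpret N: prob_space N by (rule borel_probsD[OF assms(2)])
  interpret pair_prob_space M N ..
  show "prob_space (M \<Otimes>\<^sub>M N)" by (rule prob_space_axioms)
  show "sets (M \<Otimes>\<^sub>M N) = sets borel"
    using sets_pair_measure_cong[OF borel_probsD(2)[OF assms(1)] borel_probsD(2)[OF assms(2)]]
    by (simp add: sets_pair_borel)
qed

lemma pair_measure_eqI_continuous:
  fixes M :: "'a::{metric_space,second_countable_topology} measure"
    and N :: "'b::{metric_space,second_countable_topology} measure"
  assumes M: "M \<in> borel_probs" and N: "N \<in> borel_probs" and Q: "Q \<in> borel_probs"
    and eq: "\<And>(f :: 'a \<Rightarrow> real) (g :: 'b \<Rightarrow> real). continuous_on UNIV f \<Longrightarrow> (\<And>x. 0 \<le> f x) \<Longrightarrow> (\<And>x. f x \<le> 1) \<Longrightarrow>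
      continuous_on UNIV g \<Longrightarrow> (\<And>x. 0 \<le> g x) \<Longrightarrow> (\<And>x. g x \<le> 1) \<Longrightarrow>
      (\<integral>z. f (fst z) * g (snd z) \<partial>Q) = (\<integral>x. f x \<partial>M) * (\<integral>y. g y \<partial>N)"
  shows "Q = M \<Otimes>\<^sub>M N"
proof -
  interpret M: prob_space M by (rule borel_probsD[OF M])
  interpret N: prob_space N by (rule borel_probsD[OF N])
  interpret Q: prob_space Q by (rule borel_probsD[OF Q])
  let ?E = "{a \<times> b | (a :: 'a set) (b :: 'b set). a \<in> {S. open S} \<and> b \<in> {S. open S}}"
  have "sets (borel \<Otimes>\<^sub>M borel :: ('a \<times> 'b) measure) = sets (sigma (space borel \<times> space borel) ?E)"
    by (rule sets_pair_eq[where Ca="{UNIV}" and Cb="{UNIV}"]) (auto simp: sets_borel)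
  then have gen: "sets (borel :: ('a \<times> 'b) measure) = sigma_sets UNIV ?E"
    by (simp add: sets_pair_borel sets_measure_of_conv)
  show ?thesis
  proof (rule measure_eqI_generator_eq[where E="?E" and \<Omega>=UNIV and A="\<lambda>_. UNIV"])
    fix X assume "X \<in> ?E"
    then obtain U :: "'a set" and V :: "'b set" where UV: "X = U \<times> V" "open U" "open V" by auto
    obtain f :: "nat \<Rightarrow> 'a \<Rightarrow> real" where f: "\<And>k. continuous_on UNIV (f k)" "\<And>k x. 0 \<le> f k x"
      "\<And>k x. f k x \<le> indicator U x" "\<And>x. (\<lambda>k. f k x) \<longlonglongrightarrow> indicator U x"
      using open_indicator_limit[OF UV(2)] by blast
    obtain g :: "nat \<Rightarrow> 'b \<Rightarrow> real" where g: "\<And>k. continuous_on UNIV (g k)" "\<And>k x. 0 \<le> g k x"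
      "\<And>k x. g k x \<le> indicator V x" "\<And>x. (\<lambda>k. g k x) \<longlonglongrightarrow> indicator V x"
      using open_indicator_limit[OF UV(3)] by blast
    have le1: "f k x \<le> 1" "g k y \<le> 1" for k x y
      using order_trans[OF f(3) indicator_le_1] order_trans[OF g(3) indicator_le_1] by blast+
    have "(\<lambda>k. \<integral>z. f k (fst z) * g k (snd z) \<partial>Q) \<longlonglongrightarrow> measure Q X"
    proof (rule integral_tendsto_measure_open)
      show "continuous_on UNIV (\<lambda>z. f k (fst z) * g k (snd z))" for k
        by (intro continuous_intros continuous_on_compose2[OF f(1)] continuous_on_compose2[OF g(1)]) auto
      show "f k (fst z) * g k (snd z) \<le> indicator X z" for k z
        unfolding UV(1) indicator_times by (intro mult_mono f g) simp
      show "(\<lambda>k. f k (fst z) * g k (snd z)) \<longlonglongrightarrow> indicator X z" for z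
        unfolding UV(1) indicator_times by (intro tendsto_mult f g)
    qed (use Q borel_probsD[OF Q] UV f g open_Times Q.finite_measure_axioms in auto)
    moreover have "(\<lambda>k. (\<integral>x. f k x \<partial>M) * (\<integral>y. g k y \<partial>N)) \<longlonglongrightarrow> measure M U * measure N V"
      using borel_probsD[OF M] borel_probsD[OF N] UV f g
      by (intro tendsto_mult integral_tendsto_measure_open M.finite_measure_axioms N.finite_measure_axioms)
    moreover have "(\<integral>z. f k (fst z) * g k (snd z) \<partial>Q) = (\<integral>x. f k x \<partial>M) * (\<integral>y. g k y \<partial>N)" for k
      using f g le1 by (intro eq)
    ultimately have "measure Q X = measure M U * measure N V"
      by (simp add: LIMSEQ_unique)
    moreover have "emeasure (M \<Otimes>\<^sub>M N) X = emeasure M U * emeasure N V"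
      using UV borel_probsD[OF M] borel_probsD[OF N] by (simp add: N.emeasure_pair_measure_Times)
    ultimately show "emeasure Q X = emeasure (M \<Otimes>\<^sub>M N) X"
      by (simp add: Q.emeasure_eq_measure M.emeasure_eq_measure N.emeasure_eq_measure ennreal_mult)
  next
    show "Int_stable ?E" unfolding Int_stable_def
    proof (intro ballI)
      fix X Y assume "X \<in> ?E" "Y \<in> ?E"
      then obtain a b c d where "X = a \<times> b" "Y = c \<times> d" "open a" "open b" "open c" "open d" by blast
      then have "X \<inter> Y = (a \<inter> c) \<times> (b \<inter> d)" "open (a \<inter> c)" "open (b \<inter> d)" by auto
      then show "X \<inter> Y \<in> ?E" by blast
    qed
    show "range (\<lambda>_. UNIV) \<subseteq> ?E" using UNIV_Times_UNIV[symmetric] by blast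
  qed (use borel_probsD[OF Q] borel_probsD[OF pair_measure_in_borel_probs[OF M N]] gen in auto)
qed

section \<open>Weak convergence along a filter\<close>

text \<open>
  Convergence along arbitrary filters replaces the passage to subsequences: a subfilter plays the role
  of a subsequence, and compactness arguments need no metrizability of the space of measures.
\<close>

definition weak_limit :: "('i \<Rightarrow> 'a::topological_space measure) \<Rightarrow> 'a measure \<Rightarrow> 'i filter \<Rightarrow> bool" where
  "weak_limit M N F \<longleftrightarrow>
     (\<forall>f :: 'a \<Rightarrow> real. continuous_on UNIV f \<and> bounded (range f) \<longrightarrow>
        ((\<lambda>i. \<integral>x. f x \<partial>M i) \<longlongrightarrow> (\<integral>x. f x \<partial>N)) F)"

lemma weakly_converges_iff: "weakly_converges M N \<longleftrightarrow> weak_limit M N sequentially"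
  by (simp add: weakly_converges_def weak_limit_def)

lemma weak_limit_mono: "weak_limit M N F \<Longrightarrow> G \<le> F \<Longrightarrow> weak_limit M N G"
  unfolding weak_limit_def using tendsto_mono by blast

lemma weak_limitD:
  fixes f :: "'a::topological_space \<Rightarrow> real"
  assumes "weak_limit M N F" "continuous_on UNIV f" "\<And>x. \<bar>f x\<bar> \<le> B"
  shows "((\<lambda>i. \<integral>x. f x \<partial>M i) \<longlongrightarrow> (\<integral>x. f x \<partial>N)) F"
  using assms unfolding weak_limit_def by (auto simp: bounded_iff)

lemma weak_limit_unique:
  fixes N N' :: "'a::metric_space measure"
  assumes "F \<noteq> bot" "weak_limit M N F" "weak_limit M N' F" "N \<in> borel_probs" "N' \<in> borel_probs"
  shows "N = N'"
proof (rule finite_borel_measure_eqI)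
  fix f :: "'a \<Rightarrow> real" assume f: "continuous_on UNIV f" "\<And>x. 0 \<le> f x" "\<And>x. f x \<le> 1"
  then have "\<bar>f x\<bar> \<le> 1" for x by simp
  then show "(\<integral>x. f x \<partial>N) = (\<integral>x. f x \<partial>N')"
    using tendsto_unique[OF assms(1)] weak_limitD[OF assms(2) f(1)] weak_limitD[OF assms(3) f(1)] by blast
qed (use assms(4,5)[THEN borel_probsD(1)] assms(4,5)[THEN borel_probsD(2)] in \<open>auto simp: prob_space_def\<close>)

lemma weak_limit_open:
  fixes U :: "'a::metric_space set"
  assumes N: "N \<in> borel_probs" and lim: "weak_limit M N F" and M: "\<forall>\<^sub>F i in F. M i \<in> borel_probs"
    and "open U" and c: "c < measure N U"
  shows "\<forall>\<^sub>F i in F. c < measure (M i) U"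
proof -
  obtain f :: "nat \<Rightarrow> 'a \<Rightarrow> real" where f: "\<And>k. continuous_on UNIV (f k)" "\<And>k x. 0 \<le> f k x"
    "\<And>k x. f k x \<le> indicator U x" "\<And>x. (\<lambda>k. f k x) \<longlonglongrightarrow> indicator U x"
    using open_indicator_limit[OF \<open>open U\<close>] by blast
  have le1: "f k x \<le> 1" for k x using order_trans[OF f(3) indicator_le_1] .
  interpret N: prob_space N by (rule borel_probsD[OF N])
  have "(\<lambda>k. \<integral>x. f k x \<partial>N) \<longlonglongrightarrow> measure N U"
    by (rule integral_tendsto_measure_open[OF N.finite_measure_axioms borel_probsD(2)[OF N] \<open>open U\<close> f])
  then have "\<forall>\<^sub>F k in sequentially. c < (\<integral>x. f k x \<partial>N)" using c by (rule order_tendstoD(1))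
  then obtain k where k: "c < (\<integral>x. f k x \<partial>N)" by (meson eventually_sequentially order_refl)
  have "((\<lambda>i. \<integral>x. f k x \<partial>M i) \<longlongrightarrow> (\<integral>x. f k x \<partial>N)) F"
    by (rule weak_limitD[OF lim f(1), of _ 1]) (use f(2) le1 in auto)
  then have "\<forall>\<^sub>F i in F. c < (\<integral>x. f k x \<partial>M i)" using k by (rule order_tendstoD(1))
  then show ?thesis using M
  proof eventually_elim
    case (elim i)
    interpret Mi: prob_space "M i" by (rule borel_probsD[OF elim(2)])
    note Mi = borel_probsD[OF elim(2)]
    have "(\<integral>x. f k x \<partial>M i) \<le> (\<integral>x. indicator U x \<partial>M i)"
      by (intro integral_mono integrable_bounded_borel[where B=1] f(3) Mi.finite_measure_axioms Mi)
        (use f(1,2) le1 \<open>open U\<close> in \<open>auto intro: borel_measurable_continuous_onI\<close>)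
    then show ?case using elim(1) Mi(3) by simp
  qed
qed

text \<open>
  Layer-cake approximation: up to an error \<open>1/n\<close>, the function \<open>f\<close> is the average of the indicators of
  its open superlevel sets \<open>U k = {f > k/n}\<close>, so lower bounds for measures of open sets integrate to a
  lower bound for the integral.
\<close>

lemma weak_limit_open_lower_integral:
  fixes f :: "'a::metric_space \<Rightarrow> real"
  assumes N: "N \<in> borel_probs" and M: "\<forall>\<^sub>F i in F. M i \<in> borel_probs"
    and opens: "\<And>U c. open U \<Longrightarrow> c < measure N U \<Longrightarrow> \<forall>\<^sub>F i in F. c < measure (M i) U"
    and f: "continuous_on UNIV f" "\<And>x. 0 \<le> f x" "\<And>x. f x \<le> 1" and e: "e > 0"
  shows "\<forall>\<^sub>F i in F. (\<integral>x. f x \<partial>N) - e < (\<integral>x. f x \<partial>M i)"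
proof -
  obtain m where m: "inverse (real (Suc m)) < e / 2" using reals_Archimedean[of "e / 2"] e by auto
  define n where "n = Suc m"
  have n: "n > 0" "1 / real n < e / 2" using m by (auto simp: n_def inverse_eq_divide)
  define U where "U k = {x. real k / real n < f x}" for k
  have U: "open (U k)" for k unfolding U_def by (intro open_Collect_less continuous_intros f)
  define s where "s x = (\<Sum>k\<in>{1..n}. indicator (U k) x / real n)" for x :: 'a
  have s: "s x \<le> f x \<and> f x \<le> s x + 1 / real n" for x
  proof -
    \<comment> \<open>The point \<open>x\<close> belongs to \<open>U k\<close> exactly for \<open>1 \<le> k \<le> c\<close>.\<close>
    define c where "c = \<lceil>real n * f x\<rceil> - 1"
    have c: "real_of_int c < real n * f x" "real n * f x \<le> real_of_int c + 1"
      unfolding c_def by linarith+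
    have c_le: "c < int n"
      using c(1) f(3)[of x] n(1) mult_left_le[of "f x" "real n"] by linarith
    have "{k\<in>{1..n}. x \<in> U k} = {1..nat c}"
    proof safe
      fix k assume k: "k \<in> {1..n}" "x \<in> U k"
      then have "real k < real n * f x" using n(1) by (simp add: U_def field_simps)
      then have "int k \<le> c" using c(2) by linarith
      then show "k \<in> {1..nat c}" using k by auto
    next
      fix k assume k: "k \<in> {1..nat c}"
      then have "real k \<le> real_of_int c" "1 \<le> k" by auto
      then show "x \<in> U k" "k \<in> {1..n}" using c(1) n(1) c_le k by (auto simp: U_def field_simps)
    qed
    then have "card {k\<in>{1..n}. x \<in> U k} = nat c" by simp
    moreover have "s x = real (card {k\<in>{1..n}. x \<in> U k}) / real n"
      unfolding s_def by (simp add: sum_divide_distrib[symmetric] indicator_def sum.If_cases Int_def)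
    ultimately have sx: "s x = real (nat c) / real n" by simp
    have "0 \<le> real n * f x" using f(2)[of x] by simp
    moreover have "real (nat c) = (if 0 \<le> c then real_of_int c else 0)" by simp
    moreover have "c < 0 \<Longrightarrow> real_of_int c + 1 \<le> 0" by linarith
    ultimately have "real (nat c) \<le> real n * f x" "real n * f x \<le> real (nat c) + 1"
      using c by (auto split: if_splits)
    then show ?thesis using n(1) unfolding sx by (simp add: field_simps)
  qed
  have int_s: "integrable Q s \<and> (\<integral>x. s x \<partial>Q) = (\<Sum>k\<in>{1..n}. measure Q (U k) / real n)"
    if Q: "Q \<in> borel_probs" for Q
  proof -
    interpret Q: prob_space Q by (rule borel_probsD[OF Q])
    have "U k \<in> sets Q" for k using U borel_probsD(2)[OF Q] by simp
    then show ?thesis unfolding s_def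
      by (auto simp: Q.emeasure_eq_measure borel_probsD(3)[OF Q])
  qed
  have int_f: "integrable Q f" if Q: "Q \<in> borel_probs" for Q
    by (rule integrable_bounded_borel[where B=1])
      (use f borel_probsD[OF Q] in \<open>auto simp: prob_space_def intro: borel_measurable_continuous_onI\<close>)
  have "\<forall>\<^sub>F i in F. \<forall>k\<in>{1..n}. measure N (U k) - e/2 < measure (M i) (U k)"
    by (rule eventually_ball_finite) (use opens U e in auto)
  then show ?thesis using M
  proof eventually_elim
    case (elim i)
    interpret N: prob_space N by (rule borel_probsD[OF N])
    have "(\<integral>x. f x \<partial>N) \<le> (\<integral>x. s x + 1 / real n \<partial>N)"
      using s int_s[OF N] int_f[OF N] by (intro integral_mono) auto
    also have "\<dots> = (\<Sum>k\<in>{1..n}. measure N (U k) / real n) + 1 / real n"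
      using int_s[OF N] by (simp add: N.prob_space)
    also have "\<dots> < (\<Sum>k\<in>{1..n}. measure N (U k) / real n) + e / 2" using n by simp
    also have "\<dots> \<le> (\<Sum>k\<in>{1..n}. (measure (M i) (U k) + e/2) / real n) + e/2"
      using elim(1) n(1) by (intro add_mono sum_mono divide_right_mono) (auto intro: less_imp_le simp: algebra_simps)
    also have "\<dots> = (\<Sum>k\<in>{1..n}. measure (M i) (U k) / real n) + e"
      using n(1) by (simp add: add_divide_distrib sum.distrib)
    also have "(\<Sum>k\<in>{1..n}. measure (M i) (U k) / real n) = (\<integral>x. s x \<partial>M i)"
      using int_s[OF elim(2)] by simp
    also have "\<dots> \<le> (\<integral>x. f x \<partial>M i)"
      using s int_s[OF elim(2)] int_f[OF elim(2)] by (intro integral_mono) auto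
    finally show ?case by simp
  qed
qed

text \<open>
  The upper bound for the integrals comes from applying the lower bound to \<open>1 - g\<close>, where \<open>g\<close> is \<open>f\<close>
  rescaled to take values in the unit interval.
\<close>

lemma weak_limit_from_opens:
  fixes N :: "'a::metric_space measure"
  assumes N: "N \<in> borel_probs" and M: "\<forall>\<^sub>F i in F. M i \<in> borel_probs"
    and opens: "\<And>U c. open U \<Longrightarrow> c < measure N U \<Longrightarrow> \<forall>\<^sub>F i in F. c < measure (M i) U"
  shows "weak_limit M N F"
  unfolding weak_limit_def
proof (intro allI impI, elim conjE)
  fix f :: "'a \<Rightarrow> real" assume f: "continuous_on UNIV f" "bounded (range f)"
  then obtain B where B: "B > 0" "\<And>x. \<bar>f x\<bar> \<le> B" by (auto simp: bounded_pos)
  define g where "g x = (f x + B) / (2 * B)" for x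
  have f_bounds: "- B \<le> f x" "f x \<le> B" for x using B(2)[of x] by auto
  have g: "continuous_on UNIV g" "0 \<le> g x" "g x \<le> 1" for x
    unfolding g_def using f(1) B(1) f_bounds[of x] by (auto intro!: continuous_intros simp: divide_simps)
  have g': "continuous_on UNIV (\<lambda>x. 1 - g x)" "0 \<le> 1 - g x" "1 - g x \<le> 1" for x
    using g by (auto intro!: continuous_intros)
  have int: "(\<integral>x. f x \<partial>Q) = 2 * B * (\<integral>x. g x \<partial>Q) - B \<and> (\<integral>x. 1 - g x \<partial>Q) = 1 - (\<integral>x. g x \<partial>Q)"
    if Q: "Q \<in> borel_probs" for Q
  proof -
    interpret Q: prob_space Q by (rule borel_probsD[OF Q])
    have "integrable Q g"
      by (rule integrable_bounded_borel[where B=1])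
        (use g borel_probsD[OF Q] Q.finite_measure_axioms in \<open>auto intro: borel_measurable_continuous_onI\<close>)
    moreover have "f = (\<lambda>x. 2 * B * g x - B)" using B(1) by (auto simp: g_def)
    ultimately show ?thesis by (simp add: Q.prob_space)
  qed
  show "((\<lambda>i. \<integral>x. f x \<partial>M i) \<longlongrightarrow> (\<integral>x. f x \<partial>N)) F"
  proof (rule tendstoI)
    fix e :: real assume "e > 0"
    then have e: "e / (2 * B) > 0" using B by simp
    have "\<forall>\<^sub>F i in F. (\<integral>x. g x \<partial>N) - e / (2 * B) < (\<integral>x. g x \<partial>M i)"
      by (intro weak_limit_open_lower_integral N M opens g e)
    moreover have "\<forall>\<^sub>F i in F. (\<integral>x. 1 - g x \<partial>N) - e / (2 * B) < (\<integral>x. 1 - g x \<partial>M i)"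
      by (intro weak_limit_open_lower_integral N M opens g' e)
    ultimately show "\<forall>\<^sub>F i in F. dist (\<integral>x. f x \<partial>M i) (\<integral>x. f x \<partial>N) < e"
      using M
    proof eventually_elim
      case (elim i)
      then have "\<bar>(\<integral>x. g x \<partial>M i) - (\<integral>x. g x \<partial>N)\<bar> < e / (2 * B)"
        using int[OF N] int[OF elim(3)] by linarith
      then have "2 * B * \<bar>(\<integral>x. g x \<partial>M i) - (\<integral>x. g x \<partial>N)\<bar> < e"
        using B(1) by (simp add: field_simps)
      moreover have "(\<integral>x. f x \<partial>M i) - (\<integral>x. f x \<partial>N) = 2 * B * ((\<integral>x. g x \<partial>M i) - (\<integral>x. g x \<partial>N))"
        using int[OF N] int[OF elim(3)] by (simp add: algebra_simps)
      ultimately show ?case using B(1) by (simp add: dist_real_def abs_mult)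
    qed
  qed
qed

section \<open>Weak limits of couplings\<close>

text \<open>
  Tychonoff's theorem: the functions \<open>\<Phi> i\<close> lie in a compact product of unit intervals, so they have a
  cluster point, and a finer filter converges to it in every coordinate.
\<close>

lemma bounded_functions_cluster:
  fixes \<Phi> :: "'i \<Rightarrow> 'c \<Rightarrow> real"
  assumes "F \<noteq> bot" and bounds: "\<And>i c. 0 \<le> \<Phi> i c" "\<And>i c. \<Phi> i c \<le> 1"
  obtains G a where "G \<le> F" "G \<noteq> bot" "\<And>c. ((\<lambda>i. \<Phi> i c) \<longlongrightarrow> a c) G"
proof -
  let ?K = "Pi\<^sub>E UNIV (\<lambda>_ :: 'c. {0..1 :: real})"
  have "compactin (product_topology (\<lambda>_ :: 'c. euclidean :: real topology) UNIV) ?K"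
    unfolding compactin_PiE by simp
  then have "compact ?K" by (simp add: euclidean_product_topology)
  moreover have "filtermap \<Phi> F \<noteq> bot" using assms(1) by (simp add: filtermap_bot_iff)
  moreover have "eventually (\<lambda>f. f \<in> ?K) (filtermap \<Phi> F)"
    using bounds by (simp add: eventually_filtermap PiE_iff)
  ultimately obtain a where a: "inf (nhds a) (filtermap \<Phi> F) \<noteq> bot"
    unfolding compact_filter by blast
  define G where "G = inf F (filtercomap \<Phi> (nhds a))"
  have "G \<noteq> bot"
  proof
    assume "G = bot"
    then have "eventually (\<lambda>_. False) G" by simp
    then obtain P Q where PQ: "eventually P F" "eventually Q (nhds a)" "\<And>i. P i \<Longrightarrow> Q (\<Phi> i) \<Longrightarrow> False"
      unfolding G_def eventually_inf eventually_filtercomap by blast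
    have "eventually (\<lambda>f. \<not> Q f) (filtermap \<Phi> F)"
      unfolding eventually_filtermap by (intro eventually_mono[OF PQ(1)]) (use PQ(3) in blast)
    then have "eventually (\<lambda>_. False) (inf (nhds a) (filtermap \<Phi> F))"
      unfolding eventually_inf using PQ(2) by blast
    then show False using a by (simp add: eventually_False)
  qed
  moreover have "G \<le> F" by (simp add: G_def)
  moreover have "((\<lambda>i. \<Phi> i c) \<longlongrightarrow> a c) G" for c
  proof -
    have lim: "filterlim \<Phi> (nhds a) G"
      unfolding filterlim_iff_le_filtercomap by (simp add: G_def)
    show ?thesis
    proof (rule topological_tendstoI)
      fix S :: "real set" assume S: "open S" "a c \<in> S"
      have "open ((\<lambda>f :: 'c \<Rightarrow> real. f c) -` S)"
        by (rule open_vimage[OF S(1)]) simp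
      then have "eventually (\<lambda>f. f c \<in> S) (nhds a)"
        unfolding eventually_nhds using S(2) by (intro exI[of _ "(\<lambda>f. f c) -` S"]) auto
      then show "\<forall>\<^sub>F i in G. \<Phi> i c \<in> S" using lim unfolding filterlim_iff by blast
    qed
  qed
  ultimately show thesis using that by blast
qed

lemma couplingsD:
  assumes "P \<in> couplings M N"
  shows "P \<in> borel_probs" "distr P borel fst = M" "distr P borel snd = N"
  using assms by (auto simp: couplings_def)

lemma measurable_fst_snd_borel:
  assumes "sets P = sets (borel :: ('a::topological_space \<times> 'b::topological_space) measure)"
  shows "fst \<in> measurable P borel" "snd \<in> measurable P borel"
  unfolding measurable_cong_sets[OF assms refl]
  by (intro borel_measurable_continuous_onI continuous_intros continuous_on_fst continuous_on_snd continuous_on_id)+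

lemma couplings_marginal_borel_probs:
  assumes "P \<in> couplings M N"
  shows "M \<in> borel_probs" "N \<in> borel_probs"
proof -
  interpret P: prob_space P by (rule borel_probsD[OF couplingsD(1)[OF assms]])
  have "prob_space (distr P borel fst)" "prob_space (distr P borel snd)"
    using measurable_fst_snd_borel[OF borel_probsD(2)[OF couplingsD(1)[OF assms]]]
    by (auto intro: P.prob_space_distr)
  then show "M \<in> borel_probs" "N \<in> borel_probs"
    using couplingsD(2,3)[OF assms] by (auto intro!: borel_probsI)
qed

lemma couplings_integral:
  fixes f :: "'a::topological_space \<Rightarrow> real" and g :: "'b::topological_space \<Rightarrow> real"
  assumes P: "P \<in> couplings M N"
  shows "f \<in> borel_measurable borel \<Longrightarrow> (\<integral>z. f (fst z) \<partial>P) = (\<integral>x. f x \<partial>M)"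
    and "g \<in> borel_measurable borel \<Longrightarrow> (\<integral>z. g (snd z) \<partial>P) = (\<integral>y. g y \<partial>N)"
  using measurable_fst_snd_borel[OF borel_probsD(2)[OF couplingsD(1)[OF P]]]
  by (simp_all add: integral_distr flip: couplingsD(2,3)[OF P])

lemma couplings_measure:
  assumes P: "P \<in> couplings M N"
  shows "U \<in> sets borel \<Longrightarrow> measure P {z. fst z \<in> U} = measure M U"
    and "V \<in> sets borel \<Longrightarrow> measure P {z. snd z \<in> V} = measure N V"
  using measurable_fst_snd_borel[OF borel_probsD(2)[OF couplingsD(1)[OF P]]] borel_probsD(3)[OF couplingsD(1)[OF P]]
  by (simp_all add: measure_distr vimage_def flip: couplingsD(2,3)[OF P])

lemma couplings_measure_Times:
  fixes M :: "'a::second_countable_topology measure" and N :: "'b::second_countable_topology measure"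
  assumes P: "P \<in> couplings M N" and UV: "U \<in> sets borel" "V \<in> sets borel"
  shows "measure M U + measure N V - 1 \<le> measure P (U \<times> V)"
proof -
  interpret P: prob_space P by (rule borel_probsD[OF couplingsD(1)[OF P]])
  note bP = borel_probsD[OF couplingsD(1)[OF P]]
  note meas = measurable_fst_snd_borel[OF bP(2)]
  have A: "{z. fst z \<in> U} \<in> sets P" and B: "{z. snd z \<in> V} \<in> sets P"
    using measurable_sets[OF meas(1) UV(1)] measurable_sets[OF meas(2) UV(2)] by (simp_all add: vimage_def bP(3))
  have "U \<times> V = {z. fst z \<in> U} \<inter> {z. snd z \<in> V}" by auto
  moreover have "measure P ({z. fst z \<in> U} \<union> {z. snd z \<in> V}) \<le> 1" by simp
  moreover have "measure P ({z. fst z \<in> U} \<union> {z. snd z \<in> V}) =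
      measure P {z. fst z \<in> U} + measure P {z. snd z \<in> V} - measure P ({z. fst z \<in> U} \<inter> {z. snd z \<in> V})"
    using A B by (simp add: measure_Un3 P.fmeasurable_eq_sets)
  ultimately show ?thesis using couplings_measure[OF P] UV by simp
qed

lemma compact_inner_approximation:
  fixes N :: "'a::{complete_space,second_countable_topology} measure"
  assumes N: "N \<in> borel_probs" and "e > 0"
  obtains K where "compact K" "1 - e < measure N K"
proof -
  interpret N: prob_space N by (rule borel_probsD[OF N])
  have "emeasure N UNIV = (SUP K \<in> {K. K \<subseteq> UNIV \<and> compact K}. emeasure N K)"
    by (rule inner_regular) (use borel_probsD[OF N] N.emeasure_finite in auto)
  moreover have "ennreal (1 - e) < emeasure N UNIV"
    using N.emeasure_space_1 borel_probsD(3)[OF N] \<open>e > 0\<close>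
    by (simp add: ennreal_less_one_iff)
  ultimately obtain K where K: "compact K" "ennreal (1 - e) < emeasure N K"
    by (auto simp: less_SUP_iff)
  then have "1 - e < measure N K"
    by (metis N.emeasure_eq_measure ennreal_leI not_le)
  then show thesis using K(1) that by blast
qed

text \<open>
  The compact set is a rectangle whose sides have large mass under the limit marginals. Every open
  neighbourhood of it contains an open rectangle around it (Wallace's theorem), and the sides of that
  one eventually have large mass under the approximating marginals.
\<close>

lemma coupling_limit_tight:
  fixes M :: "'i \<Rightarrow> 'a::{complete_space,second_countable_topology} measure"
    and N :: "'i \<Rightarrow> 'b::{complete_space,second_countable_topology} measure"
  assumes \<mu>: "\<mu> \<in> borel_probs" "weak_limit M \<mu> F" and \<nu>: "\<nu> \<in> borel_probs" "weak_limit N \<nu> F"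
    and Q: "\<forall>\<^sub>F i in F. Q i \<in> couplings (M i) (N i)" and "e > 0"
  obtains K where "compact K"
    "\<And>U. open U \<Longrightarrow> K \<subseteq> U \<Longrightarrow> \<forall>\<^sub>F i in F. 1 - e < measure (Q i) U"
proof -
  obtain K where K: "compact K" "1 - e/2 < measure \<mu> K"
    using compact_inner_approximation[OF \<mu>(1), of "e/2"] \<open>e > 0\<close> by auto
  obtain L where L: "compact L" "1 - e/2 < measure \<nu> L"
    using compact_inner_approximation[OF \<nu>(1), of "e/2"] \<open>e > 0\<close> by auto
  have "\<forall>\<^sub>F i in F. 1 - e < measure (Q i) W" if W: "open W" "K \<times> L \<subseteq> W" for W
  proof -
    obtain U V where UV: "open U" "open V" "K \<subseteq> U" "L \<subseteq> V" "U \<times> V \<subseteq> W"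
      using Wallace_theorem_prod_topology[of euclidean K euclidean L W] K(1) L(1) W by auto
    interpret \<mu>: prob_space \<mu> by (rule borel_probsD[OF \<mu>(1)])
    interpret \<nu>: prob_space \<nu> by (rule borel_probsD[OF \<nu>(1)])
    have "measure \<mu> K \<le> measure \<mu> U" "measure \<nu> L \<le> measure \<nu> V"
      using UV borel_probsD(2)[OF \<mu>(1)] borel_probsD(2)[OF \<nu>(1)]
      by (auto intro!: \<mu>.finite_measure_mono \<nu>.finite_measure_mono)
    then have lim: "1 - e/2 < measure \<mu> U" "1 - e/2 < measure \<nu> V" using K L by simp_all
    have "\<forall>\<^sub>F i in F. M i \<in> borel_probs" "\<forall>\<^sub>F i in F. N i \<in> borel_probs"
      using Q by (auto elim!: eventually_mono intro: couplings_marginal_borel_probs)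
    from weak_limit_open[OF \<mu> this(1) UV(1) lim(1)] weak_limit_open[OF \<nu> this(2) UV(2) lim(2)] Q
    show ?thesis
    proof eventually_elim
      case (elim i)
      interpret Qi: prob_space "Q i" by (rule borel_probsD[OF couplingsD(1)[OF elim(3)]])
      have "measure (Q i) (U \<times> V) \<le> measure (Q i) W"
        using UV(5) W(1) borel_probsD(2)[OF couplingsD(1)[OF elim(3)]] by (intro Qi.finite_measure_mono) auto
      then show ?case using couplings_measure_Times[OF elim(3), of U V] UV elim by simp
    qed
  qed
  moreover have "compact (K \<times> L)" using K(1) L(1) by (rule compact_Times)
  ultimately show thesis using that by blast
qed

text \<open>
  Prokhorov's theorem for couplings with convergent marginals. The limits \<open>a U\<close> of the masses of all
  sets along a finer filter \<open>G\<close> dominate a measure \<open>P\<close> on the open sets; since the total masses agree,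
  this domination is weak convergence, and the marginals of \<open>P\<close> are identified by uniqueness of weak
  limits.
\<close>

lemma coupling_limit:
  fixes M :: "'i \<Rightarrow> 'a::{complete_space,second_countable_topology} measure"
    and N :: "'i \<Rightarrow> 'b::{complete_space,second_countable_topology} measure"
  assumes "F \<noteq> bot"
    and \<mu>: "\<mu> \<in> borel_probs" "weak_limit M \<mu> F" and \<nu>: "\<nu> \<in> borel_probs" "weak_limit N \<nu> F"
    and Q: "\<forall>\<^sub>F i in F. Q i \<in> couplings (M i) (N i)"
  obtains G P where "G \<le> F" "G \<noteq> bot" "P \<in> couplings \<mu> \<nu>" "weak_limit Q P G"
proof -
  \<comment> \<open>The truncation matters only at indices for which \<open>Q i\<close> is not a probability measure.\<close>
  define \<Phi> where "\<Phi> i U = min 1 (measure (Q i) U)" for i U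
  obtain G a where G: "G \<le> F" "G \<noteq> bot" and a: "\<And>U. ((\<lambda>i. \<Phi> i U) \<longlongrightarrow> a U) G"
    using bounded_functions_cluster[OF assms(1), of \<Phi>] by (auto simp: \<Phi>_def)
  have QG: "\<forall>\<^sub>F i in G. Q i \<in> couplings (M i) (N i)" using Q G(1) by (rule filter_leD[rotated])
  have Qb: "\<forall>\<^sub>F i in G. Q i \<in> borel_probs" using QG by eventually_elim (rule couplingsD)
  have \<Phi>: "\<Phi> i U = measure (Q i) U" if "Q i \<in> borel_probs" for i U
  proof -
    interpret Qi: prob_space "Q i" by (rule borel_probsD[OF that])
    show ?thesis by (simp add: \<Phi>_def)
  qed
  have lim: "((\<lambda>i. measure (Q i) U) \<longlongrightarrow> a U) G" for U
  proof (rule Lim_transform_eventually[OF a])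
    show "\<forall>\<^sub>F i in G. \<Phi> i U = measure (Q i) U" using Qb by eventually_elim (rule \<Phi>)
  qed
  have a_le: "a U + c \<le> a V + d" if "\<forall>\<^sub>F i in G. measure (Q i) U + c \<le> measure (Q i) V + d" for U V c d
    using tendsto_le[OF G(2) tendsto_add[OF lim tendsto_const] tendsto_add[OF lim tendsto_const] that] .
  have a_nonneg: "0 \<le> a U" for U
    by (rule tendsto_lowerbound[OF a _ G(2)]) (simp add: \<Phi>_def)
  have "\<exists>P. P \<in> borel_probs \<and> (\<forall>U. open U \<longrightarrow> emeasure P U \<le> ennreal (a U))"
  proof (rule borel_measure_below_open_set_function[of "\<lambda>U. ennreal (a U)"])
    have "a {} = 0" by (rule tendsto_unique[OF G(2) lim]) simp
    then show "ennreal (a {}) = 0" by simp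
  next
    fix U V :: "('a \<times> 'b) set" assume UV: "open U" "open V" "U \<subseteq> V"
    have "\<forall>\<^sub>F i in G. measure (Q i) U + 0 \<le> measure (Q i) V + 0" using Qb
    proof eventually_elim
      case (elim i)
      interpret Qi: prob_space "Q i" by (rule borel_probsD[OF elim])
      show ?case using UV borel_probsD(2)[OF elim] by (auto intro: Qi.finite_measure_mono)
    qed
    from a_le[OF this] show "ennreal (a U) \<le> ennreal (a V)" by (simp add: ennreal_leI)
  next
    fix U V :: "('a \<times> 'b) set" assume UV: "open U" "open V"
    have "\<forall>\<^sub>F i in G. measure (Q i) (U \<union> V) \<le> measure (Q i) U + measure (Q i) V" using Qb
    proof eventually_elim
      case (elim i)
      interpret Qi: prob_space "Q i" by (rule borel_probsD[OF elim])
      show ?case using UV borel_probsD(2)[OF elim] by (auto intro: measure_Un_le)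
    qed
    then have "a (U \<union> V) \<le> a U + a V"
      by (intro tendsto_le[OF G(2) tendsto_add[OF lim lim] lim])
    then show "ennreal (a (U \<union> V)) \<le> ennreal (a U) + ennreal (a V)"
      using a_nonneg by (simp add: ennreal_leI flip: ennreal_plus)
  next
    fix U V :: "('a \<times> 'b) set" assume UV: "open U" "open V" "U \<inter> V = {}"
    have "\<forall>\<^sub>F i in G. measure (Q i) U + measure (Q i) V \<le> measure (Q i) (U \<union> V)" using Qb
    proof eventually_elim
      case (elim i)
      interpret Qi: prob_space "Q i" by (rule borel_probsD[OF elim])
      show ?case using UV borel_probsD(2)[OF elim] Qi.finite_measure_Union[of U V] by auto
    qed
    then have "a U + a V \<le> a (U \<union> V)"
      by (intro tendsto_le[OF G(2) lim tendsto_add[OF lim lim]])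
    then show "ennreal (a U) + ennreal (a V) \<le> ennreal (a (U \<union> V))"
      using a_nonneg by (simp add: ennreal_leI flip: ennreal_plus)
  next
    have "a UNIV \<le> 1"
      by (rule tendsto_upperbound[OF a _ G(2)]) (simp add: \<Phi>_def)
    then show "ennreal (a UNIV) \<le> 1" by (simp add: ennreal_le_1)
  next
    fix e :: real assume "e > 0"
    obtain K where K: "compact K" "\<And>U. open U \<Longrightarrow> K \<subseteq> U \<Longrightarrow> \<forall>\<^sub>F i in G. 1 - e < measure (Q i) U"
      using coupling_limit_tight[OF \<mu>(1) weak_limit_mono[OF \<mu>(2) G(1)] \<nu>(1) weak_limit_mono[OF \<nu>(2) G(1)] QG \<open>e > 0\<close>]
      by blast
    have "1 \<le> ennreal (a U) + ennreal e" if "open U" "K \<subseteq> U" for U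
    proof -
      have "1 - e \<le> a U"
        by (rule tendsto_lowerbound[OF lim _ G(2)]) (use K(2)[OF that] in \<open>auto elim: eventually_mono\<close>)
      then show ?thesis using a_nonneg[of U] \<open>e > 0\<close> by (simp flip: ennreal_plus)
    qed
    then show "\<exists>K. compact K \<and> (\<forall>U. open U \<and> K \<subseteq> U \<longrightarrow> 1 \<le> ennreal (a U) + ennreal e)"
      using K(1) by blast
  qed blast
  then obtain P where P: "P \<in> borel_probs" and Pa: "\<And>U. open U \<Longrightarrow> emeasure P U \<le> ennreal (a U)" by blast
  interpret P: prob_space P by (rule borel_probsD[OF P])
  have limP: "weak_limit Q P G"
  proof (rule weak_limit_from_opens[OF P Qb])
    fix U :: "('a \<times> 'b) set" and c assume U: "open U" "c < measure P U"
    have "measure P U \<le> a U"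
      using Pa[OF U(1)] a_nonneg by (simp add: P.emeasure_eq_measure)
    then show "\<forall>\<^sub>F i in G. c < measure (Q i) U"
      using U(2) by (intro order_tendstoD(1)[OF lim]) simp
  qed
  note measP = measurable_fst_snd_borel[OF borel_probsD(2)[OF P]]
  have distrP: "distr P borel fst \<in> borel_probs" "distr P borel snd \<in> borel_probs"
    using measP by (auto intro!: borel_probsI P.prob_space_distr)
  have "weak_limit M (distr P borel fst) G"
    unfolding weak_limit_def
  proof (intro allI impI, elim conjE)
    fix f :: "'a \<Rightarrow> real" assume f: "continuous_on UNIV f" "bounded (range f)"
    then obtain B where B: "\<And>x. \<bar>f x\<bar> \<le> B" by (auto simp: bounded_iff)
    note f_meas = borel_measurable_continuous_onI[OF f(1)]
    have "((\<lambda>i. \<integral>z. f (fst z) \<partial>Q i) \<longlongrightarrow> (\<integral>z. f (fst z) \<partial>P)) G"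
      by (rule weak_limitD[OF limP, of _ B])
        (auto intro!: continuous_on_compose2[OF f(1)] continuous_intros B)
    moreover have "\<forall>\<^sub>F i in G. (\<integral>z. f (fst z) \<partial>Q i) = (\<integral>x. f x \<partial>M i)"
      using QG by eventually_elim (rule couplings_integral(1)[OF _ f_meas])
    ultimately show "((\<lambda>i. \<integral>x. f x \<partial>M i) \<longlongrightarrow> (\<integral>x. f x \<partial>distr P borel fst)) G"
      using measP f_meas by (simp add: integral_distr Lim_transform_eventually)
  qed
  then have fst_eq: "distr P borel fst = \<mu>"
    using weak_limit_unique[OF G(2) _ weak_limit_mono[OF \<mu>(2) G(1)]] distrP \<mu>(1) by blast
  have "weak_limit N (distr P borel snd) G"
    unfolding weak_limit_def
  proof (intro allI impI, elim conjE)
    fix f :: "'b \<Rightarrow> real" assume f: "continuous_on UNIV f" "bounded (range f)"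
    then obtain B where B: "\<And>x. \<bar>f x\<bar> \<le> B" by (auto simp: bounded_iff)
    note f_meas = borel_measurable_continuous_onI[OF f(1)]
    have "((\<lambda>i. \<integral>z. f (snd z) \<partial>Q i) \<longlongrightarrow> (\<integral>z. f (snd z) \<partial>P)) G"
      by (rule weak_limitD[OF limP, of _ B])
        (auto intro!: continuous_on_compose2[OF f(1)] continuous_intros B)
    moreover have "\<forall>\<^sub>F i in G. (\<integral>z. f (snd z) \<partial>Q i) = (\<integral>x. f x \<partial>N i)"
      using QG by eventually_elim (rule couplings_integral(2)[OF _ f_meas])
    ultimately show "((\<lambda>i. \<integral>x. f x \<partial>N i) \<longlongrightarrow> (\<integral>x. f x \<partial>distr P borel snd)) G"
      using measP f_meas by (simp add: integral_distr Lim_transform_eventually)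
  qed
  then have "distr P borel snd = \<nu>"
    using weak_limit_unique[OF G(2) _ weak_limit_mono[OF \<nu>(2) G(1)]] distrP \<nu>(1) by blast
  then have "P \<in> couplings \<mu> \<nu>" using P fst_eq by (simp add: couplings_def)
  then show thesis using that G limP by blast
qed

section \<open>Integrals of continuously convergent functions\<close>

text \<open>
  The integrands \<open>h n\<close> need not be continuous, so weak convergence does not apply to them. They are
  dominated for \<open>n > m\<close> by the Lipschitz envelopes \<open>V m z = SUP {h n w - m dist z w | n > m, w}\<close>, to which
  it does apply. Continuous convergence of \<open>h n\<close> to \<open>h0\<close> at \<open>z\<close> forces \<open>V m z\<close> down to \<open>h0 z\<close>, and dominated
  convergence finishes the argument.
\<close>

lemma integral_eventually_less_continuous_convergence:
  fixes h :: "nat \<Rightarrow> 'a::metric_space \<Rightarrow> real"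
  assumes G: "G \<le> sequentially" and Q: "Q \<in> borel_probs" and lim: "weak_limit M Q G"
    and M: "\<forall>\<^sub>F n in G. M n \<in> borel_probs"
    and h: "\<And>n. n \<ge> 1 \<Longrightarrow> h n \<in> borel_measurable borel" "\<And>n z. n \<ge> 1 \<Longrightarrow> \<bar>h n z\<bar> \<le> B"
    and h0: "h0 \<in> borel_measurable borel"
    and conv: "AE z in Q. ((\<lambda>p. h (fst p) (snd p)) \<longlongrightarrow> h0 z) (sequentially \<times>\<^sub>F nhds z)"
    and "e > 0"
  shows "\<forall>\<^sub>F n in G. (\<integral>z. h n z \<partial>M n) < (\<integral>z. h0 z \<partial>Q) + e"
proof -
  define v where "v m z p = h (fst p) (snd p) - real m * dist z (snd p)" for m z and p :: "nat \<times> 'a"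
  define V where "V m z = (SUP p\<in>{Suc m..} \<times> UNIV. v m z p)" for m z
  have v_le: "v m z p \<le> B" if "p \<in> {Suc m..} \<times> UNIV" for m z p
  proof -
    have "\<bar>h (fst p) (snd p)\<bar> \<le> B" using that by (intro h) auto
    moreover have "0 \<le> real m * dist z (snd p)" by simp
    ultimately show ?thesis unfolding v_def by linarith
  qed
  then have bdd: "bdd_above (v m z ` ({Suc m..} \<times> UNIV))" for m z by (intro bdd_aboveI2)
  have ne: "{Suc m..} \<times> (UNIV :: 'a set) \<noteq> {}" for m by simp
  have V_upper: "h n z \<le> V m z" if "n \<ge> Suc m" for n m z
    using cSUP_upper[OF _ bdd, of "(n, z)" m z] that by (simp add: V_def v_def)
  have V_le: "V m z \<le> c" if "\<And>p. p \<in> {Suc m..} \<times> UNIV \<Longrightarrow> v m z p \<le> c" for m z c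
    unfolding V_def using that by (intro cSUP_least ne)
  have V_bound: "\<bar>V m z\<bar> \<le> B" for m z
    using V_le[OF v_le, of m z] V_upper[of m "Suc m" z] h(2)[of "Suc m" z] by auto
  have V_step: "V m z \<le> V m w + real m * dist w z" for m z w
  proof (rule V_le)
    fix p assume p: "p \<in> {Suc m..} \<times> (UNIV :: 'a set)"
    have "v m w p \<le> V m w" unfolding V_def by (rule cSUP_upper[OF p bdd])
    moreover have "real m * dist w (snd p) \<le> real m * dist w z + real m * dist z (snd p)"
      using mult_left_mono[OF dist_triangle[of w "snd p" z], of "real m"] by (simp add: distrib_left)
    ultimately show "v m z p \<le> V m w + real m * dist w z" by (simp add: v_def)
  qed
  have V_cont: "continuous_on UNIV (V m)" for m
  proof (rule lipschitz_on_continuous_on)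
    show "(real m)-lipschitz_on UNIV (V m)"
    proof (rule lipschitz_onI)
      fix z w show "dist (V m z) (V m w) \<le> real m * dist z w"
        using V_step[of m z w] V_step[of m w z] by (simp add: dist_real_def dist_commute abs_le_iff)
    qed simp
  qed
  have V_meas: "V m \<in> borel_measurable borel" for m
    using V_cont by (rule borel_measurable_continuous_onI)
  interpret Q: prob_space Q by (rule borel_probsD[OF Q])
  have measQ: "borel_measurable Q = (borel_measurable borel :: ('a \<Rightarrow> real) set)"
    by (rule measurable_cong_sets[OF borel_probsD(2)[OF Q] refl])
  have V_tendsto: "(\<lambda>m. V m z) \<longlonglongrightarrow> h0 z"
    if conv: "((\<lambda>p. h (fst p) (snd p)) \<longlongrightarrow> h0 z) (sequentially \<times>\<^sub>F nhds z)" for z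
  proof (rule tendstoI)
    have near: "\<exists>N>0. \<exists>\<delta>>0. \<forall>n\<ge>N. \<forall>w. dist w z < \<delta> \<longrightarrow> \<bar>h n w - h0 z\<bar> < \<epsilon>" if "\<epsilon> > 0" for \<epsilon> :: real
    proof -
      have "\<forall>\<^sub>F p in sequentially \<times>\<^sub>F nhds z. dist (h (fst p) (snd p)) (h0 z) < \<epsilon>"
        using conv that by (rule tendstoD)
      then obtain P R where PR: "eventually P sequentially" "eventually R (nhds z)"
        "\<And>n w. P n \<Longrightarrow> R w \<Longrightarrow> dist (h n w) (h0 z) < \<epsilon>"
        unfolding eventually_prod_filter by auto
      obtain N where "\<And>n. n \<ge> N \<Longrightarrow> P n" using PR(1) by (auto simp: eventually_sequentially)
      moreover obtain \<delta> where "\<delta> > 0" "\<And>w. dist w z < \<delta> \<Longrightarrow> R w"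
        using PR(2) by (auto simp: eventually_nhds_metric)
      ultimately show ?thesis using PR(3)
        by (intro exI[of _ "Suc N"] conjI exI[of _ \<delta>]) (auto simp: dist_real_def)
    qed
    have "- B \<le> h0 z + \<epsilon>" if \<epsilon>: "\<epsilon> > 0" for \<epsilon> :: real
    proof -
      obtain N \<delta> where "N > 0" "\<delta> > 0" "\<forall>n\<ge>N. \<forall>w. dist w z < \<delta> \<longrightarrow> \<bar>h n w - h0 z\<bar> < \<epsilon>"
        using near[OF \<epsilon>] by auto
      then have "\<bar>h N z - h0 z\<bar> < \<epsilon>" by simp
      then show ?thesis using h(2)[of N z] \<open>N > 0\<close> by linarith
    qed
    then have h0_lower: "- B \<le> h0 z" by (rule field_le_epsilon)
    fix \<epsilon> :: real assume \<epsilon>: "\<epsilon> > 0"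
    then have \<epsilon>2: "\<epsilon> / 2 > 0" by simp
    obtain N \<delta> where N: "N > 0" "\<delta> > 0" "\<forall>n\<ge>N. \<forall>w. dist w z < \<delta> \<longrightarrow> \<bar>h n w - h0 z\<bar> < \<epsilon> / 2"
      using near[OF \<epsilon>2] by auto
    obtain K :: nat where K: "2 * B / \<delta> \<le> real K" using real_arch_simple by blast
    have "dist (V m z) (h0 z) < \<epsilon>" if m: "m \<ge> max N K" for m
    proof -
      have "\<bar>h (Suc m) z - h0 z\<bar> < \<epsilon> / 2" using N m by simp
      then have "h0 z - \<epsilon> / 2 < V m z" using V_upper[OF order_refl, of m z] by linarith
      moreover have "V m z \<le> h0 z + \<epsilon> / 2"
      proof (rule V_le)
        fix p assume p: "p \<in> {Suc m..} \<times> (UNIV :: 'a set)"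
        show "v m z p \<le> h0 z + \<epsilon> / 2"
        proof (cases "dist (snd p) z < \<delta>")
          case True
          then have "\<bar>h (fst p) (snd p) - h0 z\<bar> < \<epsilon> / 2" using N(3) p m by auto
          moreover have "0 \<le> real m * dist z (snd p)" by simp
          ultimately show ?thesis unfolding v_def by linarith
        next
          case False
          \<comment> \<open>Far from the centre the penalty alone exceeds the oscillation of the functions.\<close>
          have "2 * B \<le> real K * \<delta>" using K N(2) by (simp add: field_simps)
          also have "\<dots> \<le> real m * dist z (snd p)"
            using m False N(2) by (intro mult_mono) (auto simp: dist_commute)
          finally have "2 * B \<le> real m * dist z (snd p)" .
          moreover have "h (fst p) (snd p) \<le> B" using h(2)[of "fst p" "snd p"] p by auto
          ultimately show ?thesis using h0_lower \<epsilon>2 unfolding v_def by linarith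
        qed
      qed
      ultimately show ?thesis using \<epsilon>2 by (simp add: dist_real_def abs_less_iff)
    qed
    then show "\<forall>\<^sub>F m in sequentially. dist (V m z) (h0 z) < \<epsilon>"
      unfolding eventually_sequentially by blast
  qed
  have "(\<lambda>m. \<integral>z. V m z \<partial>Q) \<longlonglongrightarrow> (\<integral>z. h0 z \<partial>Q)"
  proof (rule integral_dominated_convergence[where w="\<lambda>_. B"])
    show "AE z in Q. (\<lambda>m. V m z) \<longlonglongrightarrow> h0 z" using conv by eventually_elim (rule V_tendsto)
  qed (use V_bound V_meas h0 in \<open>auto simp: measQ\<close>)
  then have "\<forall>\<^sub>F m in sequentially. (\<integral>z. V m z \<partial>Q) < (\<integral>z. h0 z \<partial>Q) + e"
    by (rule order_tendstoD) (use \<open>e > 0\<close> in simp)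
  then obtain m where m: "(\<integral>z. V m z \<partial>Q) < (\<integral>z. h0 z \<partial>Q) + e"
    by (meson eventually_sequentially order_refl)
  have "\<forall>\<^sub>F n in G. (\<integral>z. V m z \<partial>M n) < (\<integral>z. h0 z \<partial>Q) + e"
    by (rule order_tendstoD(2)[OF weak_limitD[OF lim V_cont V_bound] m])
  moreover have "\<forall>\<^sub>F n in G. n \<ge> Suc m"
    by (rule filter_leD[OF G]) (rule eventually_ge_at_top)
  ultimately show ?thesis using M
  proof eventually_elim
    case (elim n)
    note Mn = borel_probsD[OF elim(3)]
    interpret Mn: prob_space "M n" by (rule Mn)
    have "(\<integral>z. h n z \<partial>M n) \<le> (\<integral>z. V m z \<partial>M n)"
      using elim(2) by (intro integral_mono integrable_bounded_borel[where B=B] Mn Mn.finite_measure_axioms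
        V_meas V_bound h V_upper) auto
    then show ?case using elim(1) by simp
  qed
qed

lemma integral_tendsto_continuous_convergence:
  fixes h :: "nat \<Rightarrow> 'a::metric_space \<Rightarrow> real"
  assumes G: "G \<le> sequentially" and Q: "Q \<in> borel_probs" and lim: "weak_limit M Q G"
    and M: "\<forall>\<^sub>F n in G. M n \<in> borel_probs"
    and h: "\<And>n. n \<ge> 1 \<Longrightarrow> h n \<in> borel_measurable borel" "\<And>n z. n \<ge> 1 \<Longrightarrow> \<bar>h n z\<bar> \<le> B"
    and h0: "h0 \<in> borel_measurable borel"
    and conv: "AE z in Q. ((\<lambda>p. h (fst p) (snd p)) \<longlongrightarrow> h0 z) (sequentially \<times>\<^sub>F nhds z)"
  shows "((\<lambda>n. \<integral>z. h n z \<partial>M n) \<longlongrightarrow> (\<integral>z. h0 z \<partial>Q)) G"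
proof (rule tendstoI)
  fix e :: real assume e: "e > 0"
  have "\<forall>\<^sub>F n in G. (\<integral>z. - h n z \<partial>M n) < (\<integral>z. - h0 z \<partial>Q) + e"
  proof (rule integral_eventually_less_continuous_convergence[OF G Q lim M, where B=B])
    show "AE z in Q. ((\<lambda>p. - h (fst p) (snd p)) \<longlongrightarrow> - h0 z) (sequentially \<times>\<^sub>F nhds z)"
      using conv by eventually_elim (rule tendsto_minus)
  qed (use h h0 e in auto)
  moreover have "\<forall>\<^sub>F n in G. (\<integral>z. h n z \<partial>M n) < (\<integral>z. h0 z \<partial>Q) + e"
    by (rule integral_eventually_less_continuous_convergence[OF G Q lim M h h0 conv e])
  ultimately show "\<forall>\<^sub>F n in G. dist (\<integral>z. h n z \<partial>M n) (\<integral>z. h0 z \<partial>Q) < e"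
    by eventually_elim (simp add: dist_real_def abs_less_iff)
qed

section \<open>Exchanging the second coordinates of two points\<close>

definition exchange :: "('a \<times> 'b) \<times> ('a \<times> 'b) \<Rightarrow> ('a \<times> 'b) \<times> ('a \<times> 'b)" where
  "exchange p = ((fst (fst p), snd (snd p)), (fst (snd p), snd (fst p)))"

lemma exchange_exchange [simp]: "exchange (exchange p) = p"
  by (simp add: exchange_def)

lemma continuous_exchange: "continuous_on A (exchange :: ('a::topological_space \<times> 'b::topological_space) \<times> _ \<Rightarrow> _)"
  unfolding exchange_def by (intro continuous_intros)

lemma measurable_exchange:
  "(exchange :: ('a::topological_space \<times> 'b::topological_space) \<times> _ \<Rightarrow> _) \<in> measurable borel borel"
  by (rule borel_measurable_continuous_onI[OF continuous_exchange])

definition tensor_square :: "('z \<Rightarrow> real) \<Rightarrow> 'z \<times> 'z \<Rightarrow> real" where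
  "tensor_square r p = r (fst p) * r (snd p)"

text \<open>
  The weight compensates the asymmetry of \<open>H = tensor_square r\<close> under the exchange \<open>S\<close>:
  \<open>H * exchange_weight r\<close> equals \<open>H (H \<circ> S) / (H + H \<circ> S)\<close>, which is invariant. Dividing by the sum keeps the
  weight in the unit interval and makes it homogeneous of degree 0 in \<open>r\<close>.
\<close>

definition exchange_weight :: "('a \<times> 'b \<Rightarrow> real) \<Rightarrow> ('a \<times> 'b) \<times> ('a \<times> 'b) \<Rightarrow> real" where
  "exchange_weight r p =
     tensor_square r (exchange p) / (tensor_square r p + tensor_square r (exchange p))"

lemma tensor_square_pos: "(\<And>z. 0 < r z) \<Longrightarrow> 0 < tensor_square r p"
  by (simp add: tensor_square_def)

lemma exchange_weight_pos: "(\<And>z. 0 < r z) \<Longrightarrow> 0 < exchange_weight r p"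
  by (simp add: exchange_weight_def tensor_square_pos add_pos_pos)

lemma exchange_weight_le_1: "(\<And>z. 0 < r z) \<Longrightarrow> exchange_weight r p \<le> 1"
  using tensor_square_pos[of r p] tensor_square_pos[of r "exchange p"]
  by (simp add: exchange_weight_def)

lemma exchange_weight_scale: "c \<noteq> 0 \<Longrightarrow> exchange_weight (\<lambda>z. r z / c) = exchange_weight r"
  by (rule ext) (simp add: exchange_weight_def tensor_square_def field_simps flip: add_divide_distrib)

lemma measurable_tensor_square:
  fixes r :: "'z::topological_space \<Rightarrow> real"
  assumes "r \<in> borel_measurable borel"
  shows "tensor_square r \<in> borel_measurable borel"
  unfolding tensor_square_def
  using measurable_compose[OF measurable_fst_snd_borel(1)[OF refl] assms]
    measurable_compose[OF measurable_fst_snd_borel(2)[OF refl] assms]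
  by (rule borel_measurable_times)

lemma measurable_exchange_weight:
  fixes r :: "'a::topological_space \<times> 'b::topological_space \<Rightarrow> real"
  assumes "r \<in> borel_measurable borel"
  shows "exchange_weight r \<in> borel_measurable borel"
proof -
  have "(\<lambda>p. tensor_square r (exchange p)) \<in> borel_measurable borel"
    by (rule measurable_compose[OF measurable_exchange measurable_tensor_square[OF assms]])
  then show ?thesis
    unfolding exchange_weight_def using measurable_tensor_square[OF assms]
    by (intro borel_measurable_divide borel_measurable_add)
qed

text \<open>
  All four coordinates are independent under \<open>P \<otimes> P\<close>, so permuting the two that have law \<open>\<nu>\<close> changes
  nothing. On rectangles this is an iterated integration.
\<close>

lemma distr_exchange_product:
  fixes \<mu> :: "'a::second_countable_topology measure" and \<nu> :: "'b::second_countable_topology measure"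
  assumes \<mu>: "\<mu> \<in> borel_probs" and \<nu>: "\<nu> \<in> borel_probs"
  defines "P \<equiv> \<mu> \<Otimes>\<^sub>M \<nu>"
  shows "distr (P \<Otimes>\<^sub>M P) borel exchange = P \<Otimes>\<^sub>M P"
proof (rule pair_measure_eqI[symmetric])
  interpret \<mu>: prob_space \<mu> by (rule borel_probsD[OF \<mu>])
  interpret \<nu>: prob_space \<nu> by (rule borel_probsD[OF \<nu>])
  interpret \<mu>\<nu>: pair_prob_space \<mu> \<nu> ..
  have P: "P \<in> borel_probs" unfolding P_def by (rule pair_measure_in_borel_probs[OF \<mu> \<nu>])
  interpret P: prob_space P by (rule borel_probsD[OF P])
  have PP: "P \<Otimes>\<^sub>M P \<in> borel_probs" by (rule pair_measure_in_borel_probs[OF P P])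
  show "sigma_finite_measure P" "sigma_finite_measure P" by unfold_locales
  show "sets (P \<Otimes>\<^sub>M P) = sets (distr (P \<Otimes>\<^sub>M P) borel exchange)" using borel_probsD[OF PP] by simp
  fix A B assume AB: "A \<in> sets P" "B \<in> sets P"
  have ex: "exchange \<in> measurable (P \<Otimes>\<^sub>M P) borel"
    by (simp add: measurable_borel_probs[OF PP] measurable_exchange)
  define F where "F x = (\<integral>\<^sup>+ y. indicator A (x, y) \<partial>\<nu>)" for x
  define H where "H y = (\<integral>\<^sup>+ x. indicator B (x, y) \<partial>\<mu>)" for y
  have iA: "(indicator A :: _ \<Rightarrow> ennreal) \<in> borel_measurable (\<mu> \<Otimes>\<^sub>M \<nu>)"
    and iB: "(indicator B :: _ \<Rightarrow> ennreal) \<in> borel_measurable (\<mu> \<Otimes>\<^sub>M \<nu>)"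
    using AB unfolding P_def by auto
  have F: "F \<in> borel_measurable \<mu>"
    unfolding F_def using \<nu>.borel_measurable_nn_integral_fst[OF iA] .
  have H: "H \<in> borel_measurable \<nu>"
    unfolding H_def using measurable_pair_swap[OF iB] by (intro \<mu>.borel_measurable_nn_integral) simp
  have slice_A: "(\<lambda>y. indicator A (x, y) :: ennreal) \<in> borel_measurable \<nu>" if "x \<in> space \<mu>" for x
    using measurable_compose[OF measurable_Pair1'[OF that] iA] .
  have slice_B: "(\<lambda>x. indicator B (x, y) :: ennreal) \<in> borel_measurable \<mu>" if "y \<in> space \<nu>" for y
    using measurable_compose[OF measurable_Pair2'[OF that] iB] .
  \<comment> \<open>With the first point fixed, the two indicators depend on different coordinates of the second.\<close>
  have inner: "(\<integral>\<^sup>+ z. indicator (A \<times> B) (exchange ((x, y), z)) \<partial>P) = F x * H y" for x y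
  proof -
    have spaces: "x \<in> space \<mu>" "y \<in> space \<nu>" using borel_probsD(3)[OF \<mu>] borel_probsD(3)[OF \<nu>] by auto
    have meas: "(\<lambda>z. indicator (A \<times> B) (exchange ((x, y), z)) :: ennreal) \<in> borel_measurable (\<mu> \<Otimes>\<^sub>M \<nu>)"
    proof -
      have "(\<lambda>z. exchange ((x, y), z)) \<in> measurable borel borel"
        unfolding exchange_def by (intro borel_measurable_continuous_onI continuous_intros)
      moreover have "A \<times> B \<in> sets borel"
        using AB borel_probsD(2)[OF PP] by (metis pair_measureI)
      ultimately have "(\<lambda>z. indicator (A \<times> B) (exchange ((x, y), z)) :: ennreal) \<in> borel_measurable borel"
        by (intro measurable_compose[OF _ borel_measurable_indicator])
      then show ?thesis using measurable_borel_probs[OF P] unfolding P_def by blast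
    qed
    have "(\<integral>\<^sup>+ z. indicator (A \<times> B) (exchange ((x, y), z)) \<partial>P)
        = (\<integral>\<^sup>+ x'. \<integral>\<^sup>+ y'. indicator B (x', y) * indicator A (x, y') \<partial>\<nu> \<partial>\<mu>)"
      unfolding P_def \<nu>.nn_integral_fst[OF meas, symmetric]
      by (intro nn_integral_cong) (auto simp: exchange_def indicator_def)
    also have "\<dots> = (\<integral>\<^sup>+ x'. indicator B (x', y) * F x \<partial>\<mu>)"
      unfolding F_def by (intro nn_integral_cong nn_integral_cmult slice_A spaces)
    also have "\<dots> = H y * F x"
      unfolding H_def by (intro nn_integral_multc slice_B spaces)
    finally show ?thesis by (simp add: mult.commute)
  qed
  have AB_sets: "A \<times> B \<in> sets borel" using AB borel_probsD(2)[OF PP] by (metis pair_measureI)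
  have meas: "(\<lambda>p. indicator (A \<times> B) (exchange p) :: ennreal) \<in> borel_measurable (P \<Otimes>\<^sub>M P)"
    by (rule measurable_compose[OF ex]) (use AB_sets in simp)
  have "(\<integral>\<^sup>+ p. indicator (A \<times> B) (exchange p) \<partial>(P \<Otimes>\<^sub>M P))
      = (\<integral>\<^sup>+ z. \<integral>\<^sup>+ z'. indicator (A \<times> B) (exchange (z, z')) \<partial>P \<partial>P)"
    by (rule P.nn_integral_fst[OF meas, symmetric])
  also have "\<dots> = (\<integral>\<^sup>+ z. F (fst z) * H (snd z) \<partial>P)"
    by (intro nn_integral_cong) (metis inner prod.collapse)
  also have "\<dots> = (\<integral>\<^sup>+ x. \<integral>\<^sup>+ y. F x * H y \<partial>\<nu> \<partial>\<mu>)"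
    unfolding P_def using F H by (subst \<nu>.nn_integral_fst[symmetric]) auto
  also have "\<dots> = (\<integral>\<^sup>+ x. F x \<partial>\<mu>) * (\<integral>\<^sup>+ y. H y \<partial>\<nu>)"
    using F H by (simp add: nn_integral_cmult nn_integral_multc)
  also have "(\<integral>\<^sup>+ x. F x \<partial>\<mu>) = emeasure P A"
    unfolding F_def P_def using \<nu>.nn_integral_fst[OF iA] AB by (simp add: P_def)
  also have "(\<integral>\<^sup>+ y. H y \<partial>\<nu>) = emeasure P B"
    unfolding H_def P_def using \<mu>\<nu>.nn_integral_snd[of "indicator B"] iB AB by (simp add: P_def)
  finally have "(\<integral>\<^sup>+ p. indicator (A \<times> B) (exchange p) \<partial>(P \<Otimes>\<^sub>M P)) = emeasure P A * emeasure P B" .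
  moreover have "(\<integral>\<^sup>+ p. indicator (A \<times> B) (exchange p) \<partial>(P \<Otimes>\<^sub>M P))
      = emeasure (distr (P \<Otimes>\<^sub>M P) borel exchange) (A \<times> B)"
    using ex AB_sets nn_integral_distr[OF ex, of "indicator (A \<times> B)"] by simp
  ultimately show "emeasure P A * emeasure P B = emeasure (distr (P \<Otimes>\<^sub>M P) borel exchange) (A \<times> B)" by simp
qed

lemma pair_measure_positive_density:
  fixes P :: "'z::second_countable_topology measure"
  assumes P: "P \<in> borel_probs" and \<pi>: "\<pi> \<in> borel_probs" and q: "positive_density \<pi> P q"
  shows "positive_density (\<pi> \<Otimes>\<^sub>M \<pi>) (P \<Otimes>\<^sub>M P) (tensor_square q)"
proof -
  interpret P: prob_space P by (rule borel_probsD[OF P])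
  interpret \<pi>: prob_space \<pi> by (rule borel_probsD[OF \<pi>])
  have q': "q \<in> borel_measurable borel" "\<And>z. 0 < q z" "\<pi> = density P (\<lambda>z. ennreal (q z))"
    using q by (auto simp: positive_density_def)
  have "(\<lambda>z. ennreal (q z)) \<in> borel_measurable P"
    using q'(1) by (simp add: measurable_borel_probs[OF P])
  moreover have "sigma_finite_measure P" "sigma_finite_measure (density P (\<lambda>z. ennreal (q z)))"
    using P.sigma_finite_measure_axioms \<pi>.sigma_finite_measure_axioms q'(3) by auto
  ultimately have "density P (\<lambda>z. ennreal (q z)) \<Otimes>\<^sub>M density P (\<lambda>z. ennreal (q z))
      = density (P \<Otimes>\<^sub>M P) (\<lambda>(x, y). ennreal (q x) * ennreal (q y))"
    by (intro pair_measure_density)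
  then have "\<pi> \<Otimes>\<^sub>M \<pi> = density (P \<Otimes>\<^sub>M P) (\<lambda>p. ennreal (tensor_square q p))"
    using q'(2) by (simp add: q'(3)[symmetric] tensor_square_def case_prod_beta' ennreal_mult less_imp_le)
  then show ?thesis
    using q' by (auto simp: positive_density_def measurable_tensor_square tensor_square_pos)
qed

text \<open>
  With respect to \<open>P \<otimes> P\<close>, the weighted measure has the exchange-invariant density
  \<open>tensor_square g * (tensor_square r * exchange_weight r)\<close>.
\<close>

lemma exchange_weight_integral_invariant:
  fixes \<mu> :: "'a::second_countable_topology measure" and \<nu> :: "'b::second_countable_topology measure"
  assumes \<mu>: "\<mu> \<in> borel_probs" and \<nu>: "\<nu> \<in> borel_probs" and \<pi>: "\<pi> \<in> borel_probs"
    and density: "positive_density \<pi> (\<mu> \<Otimes>\<^sub>M \<nu>) (\<lambda>z. g z * r z)"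
    and r: "r \<in> borel_measurable borel" "\<And>z. 0 < r z"
    and g: "\<And>p. tensor_square g (exchange p) = tensor_square g p"
    and f: "f \<in> borel_measurable borel"
  shows "(\<integral>p. f (exchange p) * exchange_weight r p \<partial>(\<pi> \<Otimes>\<^sub>M \<pi>))
    = (\<integral>p. f p * exchange_weight r p \<partial>(\<pi> \<Otimes>\<^sub>M \<pi>))"
proof -
  define P where "P = \<mu> \<Otimes>\<^sub>M \<nu>"
  have P: "P \<in> borel_probs" unfolding P_def by (rule pair_measure_in_borel_probs[OF \<mu> \<nu>])
  have PP: "P \<Otimes>\<^sub>M P \<in> borel_probs" by (rule pair_measure_in_borel_probs[OF P P])
  define d where "d = tensor_square (\<lambda>z. g z * r z)"
  have d: "d \<in> borel_measurable borel" "\<And>p. 0 < d p" "\<pi> \<Otimes>\<^sub>M \<pi> = density (P \<Otimes>\<^sub>M P) (\<lambda>p. ennreal (d p))"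
    using pair_measure_positive_density[OF P \<pi> density[folded P_def]]
    by (auto simp: positive_density_def d_def)
  have d_w: "d (exchange p) * exchange_weight r (exchange p) = d p * exchange_weight r p" for p
  proof -
    have "d p = tensor_square g p * tensor_square r p" for p
      by (simp add: d_def tensor_square_def)
    then show ?thesis using g[of p] by (simp add: exchange_weight_def add.commute)
  qed
  define k where "k p = d p * (f p * exchange_weight r p)" for p
  have w: "exchange_weight r \<in> borel_measurable borel" by (rule measurable_exchange_weight[OF r(1)])
  have k: "k \<in> borel_measurable borel"
    unfolding k_def using d(1) f w by (intro borel_measurable_times)
  have fe: "(\<lambda>p. f (exchange p)) \<in> borel_measurable borel"
    by (rule measurable_compose[OF measurable_exchange f])
  have "(\<integral>p. f (exchange p) * exchange_weight r p \<partial>(\<pi> \<Otimes>\<^sub>M \<pi>))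
      = (\<integral>p. d p * (f (exchange p) * exchange_weight r p) \<partial>(P \<Otimes>\<^sub>M P))"
    unfolding d(3) using d(1,2) fe w by (subst integral_density) (auto simp: measurable_borel_probs[OF PP] less_imp_le)
  also have "\<dots> = (\<integral>p. k (exchange p) \<partial>(P \<Otimes>\<^sub>M P))"
    unfolding k_def using d_w by (intro Bochner_Integration.integral_cong refl) (metis mult.left_commute)
  also have "\<dots> = (\<integral>p. k p \<partial>distr (P \<Otimes>\<^sub>M P) borel exchange)"
    using k by (subst integral_distr) (auto simp: measurable_borel_probs[OF PP] measurable_exchange)
  also have "\<dots> = (\<integral>p. k p \<partial>(P \<Otimes>\<^sub>M P))"
    unfolding P_def distr_exchange_product[OF \<mu> \<nu>] ..
  also have "\<dots> = (\<integral>p. f p * exchange_weight r p \<partial>(\<pi> \<Otimes>\<^sub>M \<pi>))"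
    unfolding d(3) k_def using d(1,2) f w by (subst integral_density) (auto simp: measurable_borel_probs[OF PP] less_imp_le)
  finally show ?thesis .
qed

section \<open>Equivalent measures and positive densities\<close>

lemma mutually_acI:
  assumes "M \<in> borel_probs" "N \<in> borel_probs"
    and "\<And>A. A \<in> sets borel \<Longrightarrow> emeasure M A = 0 \<longleftrightarrow> emeasure N A = 0"
  shows "mutually_ac M N"
  using assms borel_probsD(2)[OF assms(1)] borel_probsD(2)[OF assms(2)]
  by (auto simp: mutually_ac_def absolutely_continuous_def null_sets_def)

lemma mutually_ac_sym: "mutually_ac M N \<Longrightarrow> mutually_ac N M"
  by (simp add: mutually_ac_def)

lemma mutually_ac_trans: "mutually_ac L M \<Longrightarrow> mutually_ac M N \<Longrightarrow> mutually_ac L N"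
  by (auto simp: mutually_ac_def absolutely_continuous_def)

lemma mutually_ac_positive_density:
  assumes M: "M \<in> borel_probs" and N: "N \<in> borel_probs" and ac: "mutually_ac M N"
  obtains q where "positive_density N M q"
proof -
  interpret M: prob_space M by (rule borel_probsD[OF M])
  interpret N: prob_space N by (rule borel_probsD[OF N])
  have sets_eq: "sets N = sets M" using borel_probsD(2)[OF M] borel_probsD(2)[OF N] by simp
  have ac': "absolutely_continuous M N" "absolutely_continuous N M" using ac by (auto simp: mutually_ac_def)
  obtain D where D: "D \<in> borel_measurable M" "AE x in M. RN_deriv M N x = ennreal (D x)"
    "AE x in N. 0 < D x" "\<And>x. 0 \<le> D x"
    using M.real_RN_deriv[OF N.finite_measure_axioms ac'(1) sets_eq] by blast
  have D_pos: "AE x in M. 0 < D x" by (rule absolutely_continuous_AE[OF sets_eq[symmetric] ac'(2) D(3)])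
  define q where "q x = (if 0 < D x then D x else 1)" for x
  have D_borel: "D \<in> borel_measurable borel" using D(1) by (simp add: measurable_borel_probs[OF M])
  have q: "q \<in> borel_measurable borel" unfolding q_def using D_borel by measurable
  have "N = density M (RN_deriv M N)" using M.density_RN_deriv[OF ac'(1) sets_eq] by simp
  also have "\<dots> = density M (\<lambda>x. ennreal (q x))"
  proof (rule density_cong)
    show "(\<lambda>x. ennreal (q x)) \<in> borel_measurable M" using q by (simp add: measurable_borel_probs[OF M])
    show "AE x in M. RN_deriv M N x = ennreal (q x)"
      using D(2) D_pos by eventually_elim (simp add: q_def)
  qed simp
  finally have "positive_density N M q" using q by (simp add: positive_density_def q_def)
  then show thesis by (rule that)
qed

lemma emeasure_positive_density_eq_0_iff:
  assumes "M \<in> borel_probs" "f \<in> borel_measurable borel" "\<And>x. 0 < f x" "A \<in> sets borel"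
  shows "emeasure (density M (\<lambda>x. ennreal (f x))) A = 0 \<longleftrightarrow> emeasure M A = 0"
proof -
  have f: "(\<lambda>x. ennreal (f x)) \<in> borel_measurable M"
    using assms(2) by (simp add: measurable_borel_probs[OF assms(1)])
  have A: "A \<in> sets M" using assms(4) borel_probsD(2)[OF assms(1)] by simp
  have "emeasure (density M (\<lambda>x. ennreal (f x))) A = 0 \<longleftrightarrow> (AE x in M. x \<in> A \<longrightarrow> ennreal (f x) = 0)"
    using null_sets_density_iff[OF f, of A] A by (auto simp: null_sets_def)
  also have "\<dots> \<longleftrightarrow> (AE x in M. x \<notin> A)"
  proof -
    have "ennreal (f x) \<noteq> 0" for x using assms(3)[of x] by (simp add: ennreal_eq_0_iff)
    then show ?thesis by simp
  qed
  also have "\<dots> \<longleftrightarrow> emeasure M A = 0"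
    using AE_iff_null_sets[OF A] A by (auto simp: null_sets_def)
  finally show ?thesis .
qed

lemma positive_density_trans:
  assumes N: "N \<in> borel_probs" and "positive_density M N f" "positive_density L M g"
  shows "positive_density L N (\<lambda>z. g z * f z)"
proof -
  have f: "f \<in> borel_measurable borel" "\<And>z. 0 < f z" "M = density N (\<lambda>z. ennreal (f z))"
    and g: "g \<in> borel_measurable borel" "\<And>z. 0 < g z" "L = density M (\<lambda>z. ennreal (g z))"
    using assms by (auto simp: positive_density_def)
  have "L = density N (\<lambda>z. ennreal (f z) * ennreal (g z))"
    unfolding g(3) f(3) using f(1) g(1) by (intro density_density_eq) (auto simp: measurable_borel_probs[OF N])
  also have "\<dots> = density N (\<lambda>z. ennreal (g z * f z))"
    using f(2) g(2) by (simp add: ennreal_mult less_imp_le mult.commute)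
  finally show ?thesis using f g by (auto simp: positive_density_def)
qed

section \<open>Exchange invariance forces a product density\<close>

lemma exchange_invariant_measure:
  fixes Q :: "(('a::metric_space \<times> 'b::metric_space) \<times> ('a \<times> 'b)) measure"
  assumes Q: "Q \<in> borel_probs" and w: "w \<in> borel_measurable borel" "\<And>p. 0 < w p" "\<And>p. w p \<le> 1"
    and inv: "\<And>f :: _ \<Rightarrow> real. continuous_on UNIV f \<Longrightarrow> (\<And>p. 0 \<le> f p) \<Longrightarrow> (\<And>p. f p \<le> 1) \<Longrightarrow>
      (\<integral>p. f (exchange p) * w p \<partial>Q) = (\<integral>p. f p * w p \<partial>Q)"
  defines "W \<equiv> density Q (\<lambda>p. ennreal (w p))"
  shows "distr W borel exchange = W"
proof -
  interpret Q: prob_space Q by (rule borel_probsD[OF Q])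
  have wQ: "w \<in> borel_measurable Q" using w by (simp add: measurable_borel_probs[OF Q])
  have sets_W: "sets W = sets borel" "space W = UNIV" using borel_probsD[OF Q] by (auto simp: W_def)
  have W_meas: "measurable W K = measurable borel K" for K by (rule measurable_cong_sets[OF sets_W(1) refl])
  have "emeasure W UNIV = (\<integral>\<^sup>+ p. ennreal (w p) * indicator UNIV p \<partial>Q)"
    unfolding W_def using wQ borel_probsD(2)[OF Q] by (intro emeasure_density) auto
  also have "\<dots> \<le> (\<integral>\<^sup>+ p. 1 \<partial>Q)" by (rule nn_integral_mono) (simp add: w(3) ennreal_le_1)
  also have "\<dots> = 1" by (simp add: Q.emeasure_space_1)
  finally have "emeasure W (space W) \<noteq> \<infinity>" using sets_W by (auto simp: top_unique)
  then have fin: "finite_measure W" by (rule finite_measureI)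
  have ex: "exchange \<in> measurable W borel" by (simp add: W_meas measurable_exchange)
  show ?thesis
  proof (rule finite_borel_measure_eqI)
    fix f :: "('a \<times> 'b) \<times> ('a \<times> 'b) \<Rightarrow> real"
    assume f: "continuous_on UNIV f" "\<And>x. 0 \<le> f x" "\<And>x. f x \<le> 1"
    note f_meas = borel_measurable_continuous_onI[OF f(1)]
    have fe: "(\<lambda>p. f (exchange p)) \<in> borel_measurable borel"
      by (rule measurable_compose[OF measurable_exchange f_meas])
    have "(\<integral>x. f x \<partial>distr W borel exchange) = (\<integral>p. f (exchange p) \<partial>W)"
      by (rule integral_distr[OF ex f_meas])
    also have "\<dots> = (\<integral>p. f (exchange p) * w p \<partial>Q)"
      unfolding W_def using wQ fe w(2)
      by (subst integral_density) (auto simp: measurable_borel_probs[OF Q] less_imp_le mult.commute)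
    also have "\<dots> = (\<integral>p. f p * w p \<partial>Q)" by (rule inv[OF f])
    also have "\<dots> = (\<integral>p. f p \<partial>W)"
      unfolding W_def using wQ f_meas w(2)
      by (subst integral_density) (auto simp: measurable_borel_probs[OF Q] less_imp_le mult.commute)
    finally show "(\<integral>x. f x \<partial>distr W borel exchange) = (\<integral>x. f x \<partial>W)" .
  qed (use fin sets_W finite_measure.finite_measure_distr[OF fin ex] in auto)
qed

text \<open>
  Multiplication by the positive function \<open>w\<close> does not change null sets, so the null sets of \<open>\<pi> \<otimes> \<pi>\<close>
  are exchange-invariant. Comparing the law of the first point before and after the exchange gives the
  claim.
\<close>

lemma exchange_invariant_mutually_ac_product:
  fixes \<mu> :: "'a::{metric_space,second_countable_topology} measure"
    and \<nu> :: "'b::{metric_space,second_countable_topology} measure"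
  assumes \<pi>: "\<pi> \<in> couplings \<mu> \<nu>"
    and w: "w \<in> borel_measurable borel" "\<And>p. 0 < w p"
    and inv: "distr (density (\<pi> \<Otimes>\<^sub>M \<pi>) (\<lambda>p. ennreal (w p))) borel exchange
      = density (\<pi> \<Otimes>\<^sub>M \<pi>) (\<lambda>p. ennreal (w p))" (is "distr ?W _ _ = _")
  shows "mutually_ac \<pi> (\<mu> \<Otimes>\<^sub>M \<nu>)"
proof (rule mutually_acI)
  note \<mu>\<nu> = couplings_marginal_borel_probs[OF \<pi>]
  note \<pi>b = couplingsD(1)[OF \<pi>]
  show "\<pi> \<in> borel_probs" by (rule \<pi>b)
  show P: "\<mu> \<Otimes>\<^sub>M \<nu> \<in> borel_probs" by (rule pair_measure_in_borel_probs[OF \<mu>\<nu>])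
  interpret \<mu>: prob_space \<mu> by (rule borel_probsD[OF \<mu>\<nu>(1)])
  interpret \<nu>: prob_space \<nu> by (rule borel_probsD[OF \<mu>\<nu>(2)])
  interpret \<pi>: prob_space \<pi> by (rule borel_probsD[OF \<pi>b])
  have Q: "\<pi> \<Otimes>\<^sub>M \<pi> \<in> borel_probs" by (rule pair_measure_in_borel_probs[OF \<pi>b \<pi>b])
  have sets_W: "sets ?W = sets borel" "space ?W = UNIV" using borel_probsD[OF Q] by auto
  have ex: "exchange \<in> measurable (\<pi> \<Otimes>\<^sub>M \<pi>) borel" "exchange \<in> measurable ?W borel"
    using measurable_cong_sets[OF sets_W(1) refl, of borel] measurable_exchange
    by (auto simp: measurable_borel_probs[OF Q])
  have fst_ex: "(\<lambda>p. fst (exchange p)) \<in> measurable (\<pi> \<Otimes>\<^sub>M \<pi>) borel"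
    by (rule measurable_compose[OF ex(1) measurable_fst_snd_borel(1)[OF refl]])
  \<comment> \<open>After the exchange the first point combines coordinates of two independent points.\<close>
  have cross: "distr (\<pi> \<Otimes>\<^sub>M \<pi>) borel (\<lambda>p. fst (exchange p)) = \<mu> \<Otimes>\<^sub>M \<nu>"
  proof (rule pair_measure_eqI[symmetric])
    fix A B assume "A \<in> sets \<mu>" "B \<in> sets \<nu>"
    then have AB: "A \<in> sets borel" "B \<in> sets borel" using \<mu>\<nu>[THEN borel_probsD(2)] by auto
    have meas: "{z. fst z \<in> A} \<in> sets \<pi>" "{z. snd z \<in> B} \<in> sets \<pi>"
      using measurable_sets[OF measurable_fst_snd_borel(1)[OF borel_probsD(2)[OF \<pi>b]] AB(1)]
        measurable_sets[OF measurable_fst_snd_borel(2)[OF borel_probsD(2)[OF \<pi>b]] AB(2)]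
      by (auto simp: vimage_def borel_probsD(3)[OF \<pi>b])
    have "A \<times> B \<in> sets borel" using \<open>A \<in> sets \<mu>\<close> \<open>B \<in> sets \<nu>\<close> borel_probsD(2)[OF P] by (metis pair_measureI)
    then have "emeasure (distr (\<pi> \<Otimes>\<^sub>M \<pi>) borel (\<lambda>p. fst (exchange p))) (A \<times> B)
        = emeasure (\<pi> \<Otimes>\<^sub>M \<pi>) ({z. fst z \<in> A} \<times> {z. snd z \<in> B})"
      by (subst emeasure_distr[OF fst_ex]) (auto simp: borel_probsD(3)[OF Q] exchange_def intro!: arg_cong[where f="emeasure _"])
    also have "\<dots> = emeasure \<pi> {z. fst z \<in> A} * emeasure \<pi> {z. snd z \<in> B}"
      by (rule \<pi>.emeasure_pair_measure_Times[OF meas])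
    also have "\<dots> = emeasure \<mu> A * emeasure \<nu> B"
      using couplings_measure[OF \<pi>] AB
      by (simp add: \<pi>.emeasure_eq_measure \<mu>.emeasure_eq_measure \<nu>.emeasure_eq_measure)
    finally show "emeasure \<mu> A * emeasure \<nu> B
      = emeasure (distr (\<pi> \<Otimes>\<^sub>M \<pi>) borel (\<lambda>p. fst (exchange p))) (A \<times> B)" by simp
  qed (use borel_probsD(2)[OF P] in \<open>auto intro: \<mu>.sigma_finite_measure_axioms \<nu>.sigma_finite_measure_axioms\<close>)
  fix A :: "('a \<times> 'b) set" assume A: "A \<in> sets borel"
  have A\<pi>: "A \<in> sets \<pi>" using A borel_probsD(2)[OF \<pi>b] by simp
  have X: "A \<times> UNIV \<in> sets (borel :: (('a \<times> 'b) \<times> ('a \<times> 'b)) measure)"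
    using A by (metis borel_Times sets.top space_borel)
  have eX: "exchange -` (A \<times> UNIV) \<in> sets borel"
    using measurable_sets[OF measurable_exchange X] by simp
  have "emeasure \<pi> A = emeasure (\<pi> \<Otimes>\<^sub>M \<pi>) (A \<times> UNIV)"
    using \<pi>.emeasure_pair_measure_Times[OF A\<pi>, of UNIV] \<pi>.emeasure_space_1 borel_probsD(2,3)[OF \<pi>b] by simp
  then have "emeasure \<pi> A = 0 \<longleftrightarrow> emeasure ?W (A \<times> UNIV) = 0"
    using emeasure_positive_density_eq_0_iff[OF Q w X] by simp
  also have "emeasure ?W (A \<times> UNIV) = emeasure ?W (exchange -` (A \<times> UNIV))"
    using emeasure_distr[OF ex(2) X] inv sets_W(2) by simp
  also have "\<dots> = 0 \<longleftrightarrow> emeasure (\<pi> \<Otimes>\<^sub>M \<pi>) (exchange -` (A \<times> UNIV)) = 0"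
    by (rule emeasure_positive_density_eq_0_iff[OF Q w eX])
  also have "emeasure (\<pi> \<Otimes>\<^sub>M \<pi>) (exchange -` (A \<times> UNIV)) = emeasure (\<mu> \<Otimes>\<^sub>M \<nu>) A"
  proof -
    have "exchange -` (A \<times> UNIV) = (\<lambda>p. fst (exchange p)) -` A" by (simp add: vimage_def mem_Times_iff)
    then show ?thesis
      using emeasure_distr[OF fst_ex A] borel_probsD(3)[OF Q] by (simp add: cross)
  qed
  finally show "emeasure \<pi> A = 0 \<longleftrightarrow> emeasure (\<mu> \<Otimes>\<^sub>M \<nu>) A = 0" .
qed

lemma exchange_invariant_density:
  fixes \<mu> :: "'a::second_countable_topology measure" and \<nu> :: "'b::second_countable_topology measure"
  assumes \<mu>: "\<mu> \<in> borel_probs" and \<nu>: "\<nu> \<in> borel_probs"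
    and k: "k \<in> borel_measurable borel" "\<And>p. 0 \<le> k p"
  defines "PP \<equiv> (\<mu> \<Otimes>\<^sub>M \<nu>) \<Otimes>\<^sub>M (\<mu> \<Otimes>\<^sub>M \<nu>)"
  assumes inv: "distr (density PP (\<lambda>p. ennreal (k p))) borel exchange = density PP (\<lambda>p. ennreal (k p))"
  shows "AE p in PP. k (exchange p) = k p"
proof -
  have P: "\<mu> \<Otimes>\<^sub>M \<nu> \<in> borel_probs" by (rule pair_measure_in_borel_probs[OF \<mu> \<nu>])
  have PP: "PP \<in> borel_probs" unfolding PP_def by (rule pair_measure_in_borel_probs[OF P P])
  interpret PP: prob_space PP by (rule borel_probsD[OF PP])
  have kb: "(\<lambda>p. ennreal (k p)) \<in> borel_measurable borel" using k(1) by simp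
  have ke: "(\<lambda>p. ennreal (k (exchange p))) \<in> borel_measurable borel"
    using measurable_compose[OF measurable_exchange kb] .
  have ex: "exchange \<in> measurable PP borel" by (simp add: measurable_borel_probs[OF PP] measurable_exchange)
  have "density PP (\<lambda>p. ennreal (k (exchange p))) = density (distr PP borel exchange) (\<lambda>p. ennreal (k (exchange p)))"
    unfolding PP_def distr_exchange_product[OF \<mu> \<nu>] ..
  also have "\<dots> = distr (density PP (\<lambda>p. ennreal (k p))) borel exchange"
    using density_distr[OF ke ex] by simp
  finally have "density PP (\<lambda>p. ennreal (k (exchange p))) = density PP (\<lambda>p. ennreal (k p))"
    using inv by simp
  then have "AE p in PP. ennreal (k (exchange p)) = ennreal (k p)"
    using PP.density_unique_iff[of "\<lambda>p. ennreal (k (exchange p))" "\<lambda>p. ennreal (k p)"] ke kb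
    by (simp add: measurable_borel_probs[OF PP])
  then show ?thesis using k(2) by simp
qed

text \<open>
  The limit objects are described by this factorised form rather than by the cyclic identities: it is
  equivalent to them, and it is the form used in the uniqueness proof.
\<close>

definition product_density :: "('a::topological_space \<times> 'b::topological_space) measure \<Rightarrow> ('a \<times> 'b) measure \<Rightarrow> bool" where
  "product_density \<pi> R \<longleftrightarrow> (\<exists>u v. u \<in> borel_measurable borel \<and> v \<in> borel_measurable borel \<and>
     (\<forall>x. 0 < u x) \<and> (\<forall>y. 0 < v y) \<and> positive_density \<pi> R (\<lambda>z. u (fst z) * v (snd z)))"

text \<open>
  By Fubini there is a point \<open>z0 = (x0, y0)\<close> such that \<open>q (x, y) = q (x, y0) q (x0, y) / q z0\<close> for almost all
  \<open>(x, y)\<close>; the right-hand side is a positive function in product form, defined everywhere.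
\<close>

lemma product_density_of_four_point_identity:
  fixes \<mu> :: "'a::second_countable_topology measure" and \<nu> :: "'b::second_countable_topology measure"
  assumes P: "P \<in> borel_probs" and R: "positive_density R P r" and \<pi>: "positive_density \<pi> P (\<lambda>z. q z * r z)"
    and q: "q \<in> borel_measurable borel" "\<And>z. 0 < q z"
    and four: "AE p in P \<Otimes>\<^sub>M P. tensor_square q (exchange p) = tensor_square q p"
  shows "product_density \<pi> (R :: ('a \<times> 'b) measure)"
proof -
  interpret P: prob_space P by (rule borel_probsD[OF P])
  interpret PP: pair_sigma_finite P P ..
  have r: "r \<in> borel_measurable borel" "\<And>z. 0 < r z" "R = density P (\<lambda>z. ennreal (r z))"
    using R by (auto simp: positive_density_def)
  have "AE z0 in P. AE z in P. tensor_square q (exchange (z0, z)) = tensor_square q (z0, z)"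
    using PP.AE_pair[OF four] by simp
  then obtain z0 where z0: "AE z in P. tensor_square q (exchange (z0, z)) = tensor_square q (z0, z)"
    using eventually_happens'[OF P.ae_filter_bot] by blast
  define u where "u x = q (x, snd z0) / q z0" for x
  define v where "v y = q (fst z0, y)" for y
  have u: "u \<in> borel_measurable borel" and v: "v \<in> borel_measurable borel"
  proof -
    have "(\<lambda>x. (x, snd z0)) \<in> measurable borel borel" "(\<lambda>y. (fst z0, y)) \<in> measurable borel borel"
      by (intro borel_measurable_continuous_onI continuous_intros)+
    from measurable_compose[OF this(1) q(1)] measurable_compose[OF this(2) q(1)]
    show "u \<in> borel_measurable borel" "v \<in> borel_measurable borel" unfolding u_def v_def by auto
  qed
  have uv: "(\<lambda>z. u (fst z) * v (snd z)) \<in> borel_measurable borel"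
    using measurable_compose[OF measurable_fst_snd_borel(1)[OF refl] u]
      measurable_compose[OF measurable_fst_snd_borel(2)[OF refl] v]
    by (rule borel_measurable_times)
  have pos: "0 < u x" "0 < v y" for x y using q(2) by (auto simp: u_def v_def)
  have ae: "AE z in P. q z = u (fst z) * v (snd z)"
    using z0
  proof eventually_elim
    case (elim z)
    then have "q (fst z0, snd z) * q (fst z, snd z0) = q z0 * q z"
      by (simp add: tensor_square_def exchange_def)
    then show ?case using q(2)[of z0] by (simp add: u_def v_def field_simps)
  qed
  have "\<pi> = density P (\<lambda>z. ennreal (q z * r z))" using \<pi> by (simp add: positive_density_def)
  also have "\<dots> = density P (\<lambda>z. ennreal (r z) * ennreal (u (fst z) * v (snd z)))"
  proof (rule density_cong)
    show "AE z in P. ennreal (q z * r z) = ennreal (r z) * ennreal (u (fst z) * v (snd z))"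
      using ae by eventually_elim (use r(2) pos in \<open>simp add: ennreal_mult less_imp_le mult.commute\<close>)
  qed (use q r uv in \<open>auto simp: measurable_borel_probs[OF P]\<close>)
  also have "\<dots> = density R (\<lambda>z. ennreal (u (fst z) * v (snd z)))"
    unfolding r(3) using r uv by (intro density_density_eq[symmetric]) (auto simp: measurable_borel_probs[OF P])
  finally show ?thesis
    unfolding product_density_def positive_density_def
    using u v uv pos by (intro exI[of _ u] exI[of _ v]) simp
qed

text \<open>
  Once \<open>\<pi>\<close> is known to be equivalent to the product of its marginals, the invariant measure has a
  density there, and uniqueness of densities turns invariance into the identity
  \<open>q (x, y) q (x', y') = q (x, y') q (x', y)\<close> for \<open>q = d\<pi>/dR\<close>.
\<close>

lemma product_density_of_exchange_invariance:
  fixes \<mu> :: "'a::{metric_space,second_countable_topology} measure"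
    and \<nu> :: "'b::{metric_space,second_countable_topology} measure"
  assumes \<pi>: "\<pi> \<in> couplings \<mu> \<nu>" and R: "positive_density R (\<mu> \<Otimes>\<^sub>M \<nu>) r"
    and inv: "\<And>f :: _ \<Rightarrow> real. continuous_on UNIV f \<Longrightarrow> (\<And>p. 0 \<le> f p) \<Longrightarrow> (\<And>p. f p \<le> 1) \<Longrightarrow>
      (\<integral>p. f (exchange p) * exchange_weight r p \<partial>(\<pi> \<Otimes>\<^sub>M \<pi>)) = (\<integral>p. f p * exchange_weight r p \<partial>(\<pi> \<Otimes>\<^sub>M \<pi>))"
  shows "mutually_ac \<pi> (\<mu> \<Otimes>\<^sub>M \<nu>)" and "product_density \<pi> R"
proof -
  let ?P = "\<mu> \<Otimes>\<^sub>M \<nu>"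
  let ?w = "exchange_weight r"
  note \<mu>\<nu> = couplings_marginal_borel_probs[OF \<pi>]
  note \<pi>b = couplingsD(1)[OF \<pi>]
  have P: "?P \<in> borel_probs" by (rule pair_measure_in_borel_probs[OF \<mu>\<nu>])
  have PP: "?P \<Otimes>\<^sub>M ?P \<in> borel_probs" by (rule pair_measure_in_borel_probs[OF P P])
  have r: "r \<in> borel_measurable borel" "\<And>z. 0 < r z" using R by (auto simp: positive_density_def)
  note w = measurable_exchange_weight[OF r(1)] exchange_weight_pos[of r, OF r(2)] exchange_weight_le_1[of r, OF r(2)]
  have W: "distr (density (\<pi> \<Otimes>\<^sub>M \<pi>) (\<lambda>p. ennreal (?w p))) borel exchange
      = density (\<pi> \<Otimes>\<^sub>M \<pi>) (\<lambda>p. ennreal (?w p))"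
    by (rule exchange_invariant_measure[OF pair_measure_in_borel_probs[OF \<pi>b \<pi>b] w inv])
  show ac: "mutually_ac \<pi> ?P"
    by (rule exchange_invariant_mutually_ac_product[OF \<pi> w(1,2) W])
  obtain d where d: "positive_density \<pi> ?P d"
    using mutually_ac_positive_density[OF P \<pi>b mutually_ac_sym[OF ac]] .
  define q where "q z = d z / r z" for z
  have d': "d \<in> borel_measurable borel" "\<And>z. 0 < d z" using d by (auto simp: positive_density_def)
  have q: "q \<in> borel_measurable borel" "\<And>z. 0 < q z" using d' r by (auto simp: q_def[abs_def])
  have qr: "q z * r z = d z" for z using r(2)[of z] by (simp add: q_def)
  have dd: "positive_density (\<pi> \<Otimes>\<^sub>M \<pi>) (?P \<Otimes>\<^sub>M ?P) (tensor_square d)"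
    by (rule pair_measure_positive_density[OF P \<pi>b d])
  define k where "k p = tensor_square d p * ?w p" for p
  have k: "k \<in> borel_measurable borel" "\<And>p. 0 \<le> k p"
    unfolding k_def using measurable_tensor_square[OF d'(1)] w(1) tensor_square_pos[of d, OF d'(2)] w(2)
    by (auto simp: less_imp_le)
  have "density (\<pi> \<Otimes>\<^sub>M \<pi>) (\<lambda>p. ennreal (?w p))
      = density (?P \<Otimes>\<^sub>M ?P) (\<lambda>p. ennreal (tensor_square d p) * ennreal (?w p))"
    using dd w(1) unfolding positive_density_def
    by (auto simp: density_density_eq measurable_borel_probs[OF PP])
  then have "density (\<pi> \<Otimes>\<^sub>M \<pi>) (\<lambda>p. ennreal (?w p)) = density (?P \<Otimes>\<^sub>M ?P) (\<lambda>p. ennreal (k p))"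
    using tensor_square_pos[of d, OF d'(2)] w(2) by (simp add: k_def ennreal_mult less_imp_le)
  then have "AE p in ?P \<Otimes>\<^sub>M ?P. k (exchange p) = k p"
    using W by (intro exchange_invariant_density[OF \<mu>\<nu> k]) simp
  then have four: "AE p in ?P \<Otimes>\<^sub>M ?P. tensor_square q (exchange p) = tensor_square q p"
  proof eventually_elim
    case (elim p)
    let ?H = "tensor_square r p" and ?H' = "tensor_square r (exchange p)"
    have H: "0 < ?H" "0 < ?H'" by (auto intro: tensor_square_pos r(2))
    have dq: "tensor_square d p = tensor_square q p * tensor_square r p" for p
      by (simp add: tensor_square_def flip: qr)
    have "tensor_square q (exchange p) * ?H' * (?H / (?H' + ?H)) = tensor_square q p * ?H * (?H' / (?H + ?H'))"
      using elim by (simp add: k_def exchange_weight_def dq)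
    then have "tensor_square q (exchange p) * (?H * ?H') / (?H + ?H') = tensor_square q p * (?H * ?H') / (?H + ?H')"
      by (simp add: ac_simps)
    then show ?case using H by simp
  qed
  show "product_density \<pi> R"
    by (rule product_density_of_four_point_identity[OF P R _ q four]) (use d in \<open>simp add: qr\<close>)
qed

section \<open>Uniqueness of couplings with product density\<close>

text \<open>
  The relative density \<open>s = a(x) b(y)\<close> of \<open>\<pi>'\<close> with respect to \<open>\<pi>\<close> is again a product. A function of the form
  \<open>F = \<phi>(a(x)) + \<phi>(b(y))\<close> has the same integral under both couplings, so \<open>(s - 1) F\<close> has \<open>\<pi>\<close>-integral 0. The
  logarithm would make \<open>F\<close> of the sign of \<open>s - 1\<close>, but need not be integrable. The bounded choice
  \<open>\<phi> t = (t - 1) / (t + 1)\<close> does the same, since \<open>\<phi> a + \<phi> b = 2 (a b - 1) / ((a + 1) (b + 1))\<close>; hence \<open>s = 1\<close>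
  almost everywhere.
\<close>

lemma coupling_product_density_unique:
  fixes \<pi> \<pi>' :: "('a::topological_space \<times> 'b::topological_space) measure"
  assumes \<pi>: "\<pi> \<in> couplings \<mu> \<nu>" and \<pi>': "\<pi>' \<in> couplings \<mu> \<nu>" and R: "R \<in> borel_probs"
    and dens: "product_density \<pi> R" "product_density \<pi>' R"
  shows "\<pi>' = \<pi>"
proof -
  obtain u v where uv: "u \<in> borel_measurable borel" "v \<in> borel_measurable borel" "\<And>x. 0 < u x" "\<And>y. 0 < v y"
    and d: "positive_density \<pi> R (\<lambda>z. u (fst z) * v (snd z))"
    using dens(1) unfolding product_density_def by blast
  obtain u' v' where uv': "u' \<in> borel_measurable borel" "v' \<in> borel_measurable borel" "\<And>x. 0 < u' x" "\<And>y. 0 < v' y"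
    and d': "positive_density \<pi>' R (\<lambda>z. u' (fst z) * v' (snd z))"
    using dens(2) unfolding product_density_def by blast
  note \<pi>b = couplingsD(1)[OF \<pi>] and \<pi>b' = couplingsD(1)[OF \<pi>']
  interpret \<pi>: prob_space \<pi> by (rule borel_probsD[OF \<pi>b])
  interpret \<pi>': prob_space \<pi>' by (rule borel_probsD[OF \<pi>b'])
  define a where "a x = u' x / u x" for x
  define b where "b y = v' y / v y" for y
  have ab: "a \<in> borel_measurable borel" "b \<in> borel_measurable borel" "\<And>x. 0 < a x" "\<And>y. 0 < b y"
    using uv uv' by (auto simp: a_def[abs_def] b_def[abs_def])
  define s where "s z = a (fst z) * b (snd z)" for z
  have fs: "(\<lambda>z. f (fst z)) \<in> borel_measurable borel" if "f \<in> borel_measurable borel" for f :: "'a \<Rightarrow> real"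
    using measurable_compose[OF measurable_fst_snd_borel(1)[OF refl] that] .
  have sn: "(\<lambda>z. f (snd z)) \<in> borel_measurable borel" if "f \<in> borel_measurable borel" for f :: "'b \<Rightarrow> real"
    using measurable_compose[OF measurable_fst_snd_borel(2)[OF refl] that] .
  have s: "s \<in> borel_measurable borel" "\<And>z. 0 < s z"
    unfolding s_def using ab(3,4) by (auto intro!: borel_measurable_times fs[OF ab(1)] sn[OF ab(2)])
  have uv_meas: "(\<lambda>z. u (fst z) * v (snd z)) \<in> borel_measurable borel"
    using fs[OF uv(1)] sn[OF uv(2)] by (rule borel_measurable_times)
  have factor: "u (fst z) * v (snd z) * s z = u' (fst z) * v' (snd z)" for z
    using uv(3)[of "fst z"] uv(4)[of "snd z"] by (simp add: s_def a_def b_def)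
  have \<pi>'_eq: "\<pi>' = density \<pi> (\<lambda>z. ennreal (s z))"
  proof -
    have "density \<pi> (\<lambda>z. ennreal (s z)) = density (density R (\<lambda>z. ennreal (u (fst z) * v (snd z)))) (\<lambda>z. ennreal (s z))"
      using d by (simp add: positive_density_def)
    also have "\<dots> = density R (\<lambda>z. ennreal (u (fst z) * v (snd z)) * ennreal (s z))"
      using uv_meas s(1) by (intro density_density_eq) (auto simp: measurable_borel_probs[OF R])
    also have "\<dots> = density R (\<lambda>z. ennreal (u' (fst z) * v' (snd z)))"
      using uv s(2) by (simp add: factor less_imp_le flip: ennreal_mult)
    finally show ?thesis using d' by (simp add: positive_density_def)
  qed
  define \<phi> :: "real \<Rightarrow> real" where "\<phi> t = (t - 1) / (t + 1)" for t
  have \<phi>_bound: "\<bar>\<phi> t\<bar> \<le> 1" if "0 < t" for t using that by (simp add: \<phi>_def abs_le_iff divide_simps)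
  have \<phi>_meas: "\<phi> \<in> borel_measurable borel" unfolding \<phi>_def[abs_def] by measurable
  have \<phi>a: "(\<lambda>x. \<phi> (a x)) \<in> borel_measurable borel" and \<phi>b: "(\<lambda>y. \<phi> (b y)) \<in> borel_measurable borel"
    using measurable_compose[OF ab(1) \<phi>_meas] measurable_compose[OF ab(2) \<phi>_meas] by auto
  define F where "F z = \<phi> (a (fst z)) + \<phi> (b (snd z))" for z
  have F_meas: "F \<in> borel_measurable borel"
    unfolding F_def using fs[OF \<phi>a] sn[OF \<phi>b] by (rule borel_measurable_add)
  have int: "integrable P F \<and> (\<integral>z. F z \<partial>P) = (\<integral>x. \<phi> (a x) \<partial>\<mu>) + (\<integral>y. \<phi> (b y) \<partial>\<nu>)"
    if P: "P \<in> couplings \<mu> \<nu>" for P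
  proof -
    note Pb = couplingsD(1)[OF P]
    interpret P: prob_space P by (rule borel_probsD[OF Pb])
    have "integrable P (\<lambda>z. \<phi> (a (fst z)))" "integrable P (\<lambda>z. \<phi> (b (snd z)))"
      using fs[OF \<phi>a] sn[OF \<phi>b] \<phi>_bound ab(3,4)
      by (auto intro!: integrable_bounded_borel[where B=1] P.finite_measure_axioms borel_probsD[OF Pb])
    then show ?thesis
      using couplings_integral(1)[OF P \<phi>a] couplings_integral(2)[OF P \<phi>b] by (simp add: F_def[abs_def])
  qed
  have F_\<pi>: "F \<in> borel_measurable \<pi>" "s \<in> borel_measurable \<pi>"
    using F_meas s(1) by (auto simp: measurable_borel_probs[OF \<pi>b])
  have sF: "integrable \<pi> (\<lambda>z. s z * F z)" "(\<integral>z. s z * F z \<partial>\<pi>) = (\<integral>z. F z \<partial>\<pi>')"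
    using int[OF \<pi>'] F_\<pi> s(2) unfolding \<pi>'_eq
    by (auto simp: integrable_density integral_density less_imp_le)
  have "integrable \<pi> (\<lambda>z. (s z - 1) * F z)" "(\<integral>z. (s z - 1) * F z \<partial>\<pi>) = 0"
    using sF int[OF \<pi>] int[OF \<pi>'] by (auto simp: left_diff_distrib)
  moreover have F_eq: "F z = 2 * (s z - 1) / ((a (fst z) + 1) * (b (snd z) + 1))" for z
    using ab(3)[of "fst z"] ab(4)[of "snd z"] by (simp add: F_def \<phi>_def s_def divide_simps) (simp add: algebra_simps)
  moreover have "0 \<le> (s z - 1) * F z" for z
  proof -
    have "(s z - 1) * F z = 2 * (s z - 1)\<^sup>2 / ((a (fst z) + 1) * (b (snd z) + 1))"
      by (simp add: F_eq power2_eq_square)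
    then show ?thesis using ab(3)[of "fst z"] ab(4)[of "snd z"] by simp
  qed
  ultimately have "AE z in \<pi>. (s z - 1) * F z = 0"
    using integral_nonneg_eq_0_iff_AE[of \<pi> "\<lambda>z. (s z - 1) * F z"] by simp
  then have "AE z in \<pi>. ennreal (s z) = 1"
  proof eventually_elim
    case (elim z)
    have "a (fst z) + 1 \<noteq> 0" "b (snd z) + 1 \<noteq> 0" using ab(3)[of "fst z"] ab(4)[of "snd z"] by auto
    then show ?case using elim by (simp add: F_eq)
  qed
  then have "density \<pi> (\<lambda>z. ennreal (s z)) = density \<pi> (\<lambda>_. 1)"
    using F_\<pi> by (intro density_cong) auto
  then show ?thesis by (simp add: \<pi>'_eq density_1)
qed

section \<open>Supports and product measures\<close>

text \<open>
  In a second countable space the complement of the support is a countable union of null sets from a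
  basis.
\<close>

lemma AE_in_spt:
  fixes M :: "'a::second_countable_topology measure"
  assumes M: "M \<in> borel_probs"
  shows "AE x in M. x \<in> spt M"
proof -
  obtain B :: "'a set set" where B: "countable B" "topological_basis B"
    using ex_countable_basis by blast
  define N where "N = (\<Union>U\<in>{U \<in> B. emeasure M U = 0}. U)"
  have "N \<in> null_sets M"
    unfolding N_def
    by (rule null_sets_UN')
      (use B topological_basis_open[OF B(2)] borel_probsD(2)[OF M] in \<open>auto simp: null_sets_def\<close>)
  moreover have "x \<in> N" if "x \<notin> spt M" for x
  proof -
    obtain U where U: "open U" "x \<in> U" "emeasure M U = 0"
      using \<open>x \<notin> spt M\<close> by (auto simp: spt_def not_gr_zero)
    obtain V where V: "V \<in> B" "x \<in> V" "V \<subseteq> U" using topological_basisE[OF B(2) U(1,2)] by blast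
    have "emeasure M V \<le> emeasure M U"
      using V U borel_probsD(2)[OF M] by (intro emeasure_mono) auto
    then show ?thesis using V U by (auto simp: N_def)
  qed
  ultimately show ?thesis by (intro AE_I'[of N]) auto
qed

lemma spt_product:
  fixes \<mu> :: "'a::second_countable_topology measure" and \<nu> :: "'b::second_countable_topology measure"
  assumes \<mu>: "\<mu> \<in> borel_probs" and \<nu>: "\<nu> \<in> borel_probs" and R: "R \<in> borel_probs"
    and ac: "mutually_ac R (\<mu> \<Otimes>\<^sub>M \<nu>)" and z: "fst z \<in> spt \<mu>" "snd z \<in> spt \<nu>"
  shows "z \<in> spt R"
  unfolding spt_def
proof (intro CollectI allI impI)
  interpret \<nu>: prob_space \<nu> by (rule borel_probsD[OF \<nu>])
  fix W assume W: "open W" "z \<in> W"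
  obtain U V where UV: "open U" "open V" "z \<in> U \<times> V" "U \<times> V \<subseteq> W"
    using open_prod_elim[OF W] by blast
  have "0 < emeasure \<mu> U * emeasure \<nu> V"
    using z UV by (auto simp: spt_def ennreal_zero_less_mult_iff)
  also have "\<dots> = emeasure (\<mu> \<Otimes>\<^sub>M \<nu>) (U \<times> V)"
    using UV borel_probsD(2)[OF \<mu>] borel_probsD(2)[OF \<nu>] by (simp add: \<nu>.emeasure_pair_measure_Times)
  finally have "emeasure (\<mu> \<Otimes>\<^sub>M \<nu>) (U \<times> V) \<noteq> 0" by simp
  moreover have "U \<times> V \<in> sets R" using UV borel_probsD(2)[OF R] by (simp add: open_Times)
  ultimately have "emeasure R (U \<times> V) \<noteq> 0"
    using ac absolutely_continuousD[of R "\<mu> \<Otimes>\<^sub>M \<nu>" "U \<times> V"] by (auto simp: mutually_ac_def)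
  moreover have "emeasure R (U \<times> V) \<le> emeasure R W"
    using UV W borel_probsD(2)[OF R] by (intro emeasure_mono) auto
  ultimately show "0 < emeasure R W" by (auto simp: zero_less_iff_neq_zero)
qed

lemma pair_measure_in_couplings:
  fixes M :: "'a::second_countable_topology measure" and N :: "'b::second_countable_topology measure"
  assumes M: "M \<in> borel_probs" and N: "N \<in> borel_probs"
  shows "M \<Otimes>\<^sub>M N \<in> couplings M N"
proof -
  interpret M: prob_space M by (rule borel_probsD[OF M])
  interpret N: prob_space N by (rule borel_probsD[OF N])
  note MN = pair_measure_in_borel_probs[OF M N]
  note meas = measurable_fst_snd_borel[OF borel_probsD(2)[OF MN]]
  have "distr (M \<Otimes>\<^sub>M N) borel fst = M"
  proof (rule measure_eqI)
    fix A assume "A \<in> sets (distr (M \<Otimes>\<^sub>M N) borel fst)"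
    then have A: "A \<in> sets borel" by simp
    have "fst -` A \<inter> space (M \<Otimes>\<^sub>M N) = A \<times> UNIV" using borel_probsD(3)[OF MN] by auto
    then show "emeasure (distr (M \<Otimes>\<^sub>M N) borel fst) A = emeasure M A"
      using N.emeasure_pair_measure_Times[of A M UNIV] A borel_probsD[OF M] borel_probsD[OF N] N.emeasure_space_1
      by (simp add: emeasure_distr[OF meas(1)])
  qed (simp add: borel_probsD(2)[OF M])
  moreover have "distr (M \<Otimes>\<^sub>M N) borel snd = N"
  proof (rule measure_eqI)
    fix A assume "A \<in> sets (distr (M \<Otimes>\<^sub>M N) borel snd)"
    then have A: "A \<in> sets borel" by simp
    have "snd -` A \<inter> space (M \<Otimes>\<^sub>M N) = UNIV \<times> A" using borel_probsD(3)[OF MN] by auto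
    then show "emeasure (distr (M \<Otimes>\<^sub>M N) borel snd) A = emeasure N A"
      using N.emeasure_pair_measure_Times[of UNIV M A] A borel_probsD[OF M] borel_probsD[OF N] M.emeasure_space_1
      by (simp add: emeasure_distr[OF meas(2)])
  qed (simp add: borel_probsD(2)[OF N])
  ultimately show ?thesis using MN by (simp add: couplings_def)
qed

lemma integral_product_measure:
  fixes M :: "'a::second_countable_topology measure" and N :: "'b::second_countable_topology measure"
    and f :: "'a \<Rightarrow> real" and g :: "'b \<Rightarrow> real"
  assumes M: "M \<in> borel_probs" and N: "N \<in> borel_probs"
    and f: "f \<in> borel_measurable borel" "\<And>x. \<bar>f x\<bar> \<le> 1" and g: "g \<in> borel_measurable borel" "\<And>y. \<bar>g y\<bar> \<le> 1"
  shows "(\<integral>z. f (fst z) * g (snd z) \<partial>(M \<Otimes>\<^sub>M N)) = (\<integral>x. f x \<partial>M) * (\<integral>y. g y \<partial>N)"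
proof -
  interpret M: prob_space M by (rule borel_probsD[OF M])
  interpret N: prob_space N by (rule borel_probsD[OF N])
  interpret MN: pair_prob_space M N ..
  note MNb = pair_measure_in_borel_probs[OF M N]
  have "(\<lambda>z. f (fst z) * g (snd z)) \<in> borel_measurable borel"
    using measurable_compose[OF measurable_fst_snd_borel(1)[OF refl] f(1)]
      measurable_compose[OF measurable_fst_snd_borel(2)[OF refl] g(1)]
    by (rule borel_measurable_times)
  moreover have "\<bar>f x * g y\<bar> \<le> 1" for x y
    using mult_mono[OF f(2)[of x] g(2)[of y]] by (simp add: abs_mult)
  ultimately have "integrable (M \<Otimes>\<^sub>M N) (\<lambda>z. f (fst z) * g (snd z))"
    by (intro integrable_bounded_borel[where B=1] MN.finite_measure_axioms borel_probsD[OF MNb])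
  from MN.integral_fst'[OF this] show ?thesis by simp
qed

text \<open>
  Weak limits of \<open>\<pi>n \<otimes> \<pi>n\<close> are identified by testing against products \<open>f(z) g(z')\<close> only, which determine a
  measure on the product space.
\<close>

lemma weak_limit_coupling_of_self:
  fixes \<pi> :: "'z::{metric_space,second_countable_topology} measure"
  assumes "G \<noteq> bot" and \<pi>: "\<pi> \<in> borel_probs" "weak_limit \<pi>n \<pi> G" and \<pi>n: "\<forall>\<^sub>F n in G. \<pi>n n \<in> borel_probs"
    and Q: "Q \<in> borel_probs" "weak_limit (\<lambda>n. \<pi>n n \<Otimes>\<^sub>M \<pi>n n) Q G"
  shows "Q = \<pi> \<Otimes>\<^sub>M \<pi>"
proof (rule pair_measure_eqI_continuous[OF \<pi>(1) \<pi>(1) Q(1)])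
  fix f g :: "'z \<Rightarrow> real"
  assume f: "continuous_on UNIV f" "\<And>x. 0 \<le> f x" "\<And>x. f x \<le> 1"
    and g: "continuous_on UNIV g" "\<And>x. 0 \<le> g x" "\<And>x. g x \<le> 1"
  have b: "\<bar>f x\<bar> \<le> 1" "\<bar>g x\<bar> \<le> 1" "\<bar>f x * g y\<bar> \<le> 1" for x y
    using f g mult_mono[of "f x" 1 "g y" 1] by (auto simp: abs_mult)
  have "((\<lambda>n. \<integral>z. f (fst z) * g (snd z) \<partial>(\<pi>n n \<Otimes>\<^sub>M \<pi>n n)) \<longlongrightarrow> (\<integral>z. f (fst z) * g (snd z) \<partial>Q)) G"
    by (rule weak_limitD[OF Q(2), of _ 1])
      (auto intro!: continuous_intros continuous_on_compose2[OF f(1)] continuous_on_compose2[OF g(1)] b)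
  moreover have "\<forall>\<^sub>F n in G. (\<integral>z. f (fst z) * g (snd z) \<partial>(\<pi>n n \<Otimes>\<^sub>M \<pi>n n)) = (\<integral>x. f x \<partial>\<pi>n n) * (\<integral>x. g x \<partial>\<pi>n n)"
    using \<pi>n
    by eventually_elim (intro integral_product_measure b borel_measurable_continuous_onI f(1) g(1))
  ultimately have "((\<lambda>n. (\<integral>x. f x \<partial>\<pi>n n) * (\<integral>x. g x \<partial>\<pi>n n)) \<longlongrightarrow> (\<integral>z. f (fst z) * g (snd z) \<partial>Q)) G"
    by (rule Lim_transform_eventually)
  moreover have "((\<lambda>n. (\<integral>x. f x \<partial>\<pi>n n) * (\<integral>x. g x \<partial>\<pi>n n)) \<longlongrightarrow> (\<integral>x. f x \<partial>\<pi>) * (\<integral>x. g x \<partial>\<pi>)) G"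
    by (intro tendsto_mult weak_limitD[OF \<pi>(2), of _ 1] f(1) g(1) b)
  ultimately show "(\<integral>z. f (fst z) * g (snd z) \<partial>Q) = (\<integral>x. f x \<partial>\<pi>) * (\<integral>x. g x \<partial>\<pi>)"
    by (rule tendsto_unique[OF assms(1)])
qed

section \<open>Passage to the limit\<close>

lemma relative_error_tendsto:
  fixes rn :: "nat \<Rightarrow> 'a::metric_space \<times> 'b::metric_space \<Rightarrow> real"
  assumes c: "c > 0" and \<alpha>: "\<And>n. n \<ge> 1 \<Longrightarrow> \<alpha> n > 0"
    and rn: "\<And>z' n. n \<ge> 1 \<Longrightarrow> rn n z' = (1 + \<phi> z' n) * \<alpha> n * c"
    and \<phi>: "\<And>\<epsilon>. \<epsilon> > 0 \<Longrightarrow> \<exists>\<delta>>0. \<forall>z'. \<forall>n\<ge>1. max_dist z' z + 1 / real n < \<delta> \<longrightarrow> \<bar>\<phi> z' n\<bar> < (\<epsilon> :: real)"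
  shows "((\<lambda>p. rn (fst p) (snd p) / \<alpha> (fst p)) \<longlongrightarrow> c) (sequentially \<times>\<^sub>F nhds z)"
proof (rule tendstoI)
  fix e :: real assume "e > 0"
  then have "e / c > 0" using c by simp
  then obtain \<delta> where \<delta>: "\<delta> > 0"
    and small: "\<And>z' n. n \<ge> 1 \<Longrightarrow> max_dist z' z + 1 / real n < \<delta> \<Longrightarrow> \<bar>\<phi> z' n\<bar> < e / c"
    using \<phi> by meson
  \<comment> \<open>The bound \<open>\<delta>\<close> is shared equally between the distance and \<open>1/n\<close>.\<close>
  obtain N :: nat where N: "2 / \<delta> < real N" using reals_Archimedean2 by blast
  have "dist (rn n z' / \<alpha> n) c < e" if n: "n \<ge> Suc N" and z': "dist z' z < \<delta> / 2" for n z'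
  proof -
    have "max_dist z' z \<le> dist z' z"
      using dist_fst_le[of z' z] dist_snd_le[of z' z] by (simp add: max_dist_def)
    moreover have "1 / real n < \<delta> / 2"
    proof -
      have "2 / \<delta> < real n" using N n by linarith
      then show ?thesis using \<delta> n by (simp add: field_simps)
    qed
    ultimately have "\<bar>\<phi> z' n\<bar> < e / c" using z' n by (intro small) auto
    moreover have "rn n z' / \<alpha> n - c = \<phi> z' n * c"
      using rn[of n z'] \<alpha>[of n] n by (simp add: field_simps)
    ultimately show ?thesis using c by (simp add: dist_real_def abs_mult field_simps)
  qed
  moreover have "\<forall>\<^sub>F n in sequentially. n \<ge> Suc N" by (rule eventually_ge_at_top)
  moreover have "\<forall>\<^sub>F z' in nhds z. dist z' z < \<delta> / 2"
    unfolding eventually_nhds_metric using \<delta> by (intro exI[of _ "\<delta> / 2"]) auto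
  ultimately show "\<forall>\<^sub>F p in sequentially \<times>\<^sub>F nhds z. dist (rn (fst p) (snd p) / \<alpha> (fst p)) c < e"
    unfolding eventually_prod_filter by fastforce
qed

text \<open>
  The weight at a pair involves \<open>rn\<close> at four points: the two of the pair and the two of its exchange.
  Joint convergence in the index and the point at each of these passes to the weight.
\<close>

lemma exchange_weight_tendsto:
  fixes rn :: "nat \<Rightarrow> 'a::metric_space \<times> 'b::metric_space \<Rightarrow> real"
  assumes r: "\<And>z. 0 < r z"
    and lim: "\<And>z. z \<in> {fst p, snd p, fst (exchange p), snd (exchange p)} \<Longrightarrow>
      ((\<lambda>x. rn (fst x) (snd x)) \<longlongrightarrow> r z) (sequentially \<times>\<^sub>F nhds z)"
  shows "((\<lambda>x. exchange_weight (rn (fst x)) (snd x)) \<longlongrightarrow> exchange_weight r p) (sequentially \<times>\<^sub>F nhds p)"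
proof -
  have pull: "((\<lambda>x. rn (fst x) (\<psi> (snd x))) \<longlongrightarrow> r (\<psi> p)) (sequentially \<times>\<^sub>F nhds p)"
    if \<psi>: "isCont \<psi> p" "\<psi> p \<in> {fst p, snd p, fst (exchange p), snd (exchange p)}"
    for \<psi> :: "('a \<times> 'b) \<times> ('a \<times> 'b) \<Rightarrow> 'a \<times> 'b"
  proof -
    have "filterlim (\<lambda>x. (fst x, \<psi> (snd x))) (sequentially \<times>\<^sub>F nhds (\<psi> p)) (sequentially \<times>\<^sub>F nhds p)"
      by (intro filterlim_Pair filterlim_fst isCont_tendsto_compose[OF \<psi>(1)] filterlim_snd)
    from filterlim_compose[OF lim[OF \<psi>(2)] this] show ?thesis by simp
  qed
  have ex: "isCont exchange p"
    using continuous_exchange[of UNIV] continuous_on_eq_continuous_at[OF open_UNIV] by blast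
  have "isCont fst p" "isCont snd p" "isCont (\<lambda>p. fst (exchange p)) p" "isCont (\<lambda>p. snd (exchange p)) p"
    using ex by (auto intro: continuous_intros)
  note lims = this[THEN pull]
  have tensor: "((\<lambda>x. tensor_square (rn (fst x)) (snd x)) \<longlongrightarrow> tensor_square r p) (sequentially \<times>\<^sub>F nhds p)"
    "((\<lambda>x. tensor_square (rn (fst x)) (exchange (snd x))) \<longlongrightarrow> tensor_square r (exchange p)) (sequentially \<times>\<^sub>F nhds p)"
    unfolding tensor_square_def by (intro tendsto_mult lims; simp)+
  have "tensor_square r p + tensor_square r (exchange p) \<noteq> 0"
    using tensor_square_pos[of r p] tensor_square_pos[of r "exchange p"] r by (metis add_pos_pos less_irrefl)
  then show ?thesis
    unfolding exchange_weight_def by (intro tendsto_divide tendsto_add tensor)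
qed

lemma cyclic_identity_exchange:
  fixes g :: "'a \<times> 'b \<Rightarrow> real"
  assumes "\<And>(k::nat) (x :: nat \<Rightarrow> 'a) (y :: nat \<Rightarrow> 'b). y (Suc k) = y 1 \<Longrightarrow>
    (\<Prod>i=1..k. g (x i, y i)) = (\<Prod>i=1..k. g (x i, y (Suc i)))"
  shows "tensor_square g (exchange p) = tensor_square g p"
  using assms[of "\<lambda>i. if i = 2 then snd (snd p) else snd (fst p)" 2 "\<lambda>i. if i = 2 then fst (snd p) else fst (fst p)"]
  by (simp add: tensor_square_def exchange_def numeral_2_eq_2)

text \<open>
  In both products every \<open>u (x i)\<close> occurs once, and so does every \<open>v (y i)\<close>, because the shift of indices
  is cyclic.
\<close>

lemma product_density_cyclically_invariant:
  fixes \<mu> :: "'a::topological_space measure" and \<nu> :: "'b::topological_space measure"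
  assumes "\<pi> \<in> couplings \<mu> \<nu>" "R \<in> borel_probs" "mutually_ac \<pi> R" "mutually_ac R (\<mu> \<Otimes>\<^sub>M \<nu>)"
    and dens: "product_density \<pi> R"
  shows "cyclically_invariant \<mu> \<nu> \<pi> R"
proof -
  obtain u v where uv: "\<And>x. 0 < u x" "\<And>y. 0 < v y"
    and d: "positive_density \<pi> R (\<lambda>z. u (fst z) * v (snd z))"
    using dens unfolding product_density_def by blast
  have "(\<Prod>i=1..k. u (fst (x i, y i)) * v (snd (x i, y i)))
      = (\<Prod>i=1..k. u (fst (x i, y (Suc i))) * v (snd (x i, y (Suc i))))"
    if y: "y (Suc k) = y 1" for k :: nat and x :: "nat \<Rightarrow> 'a" and y :: "nat \<Rightarrow> 'b"
  proof -
    have "(\<Prod>i=1..m. v (y i)) * v (y (Suc m)) = (\<Prod>i=1..m. v (y (Suc i))) * v (y 1)" for m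
      by (induction m) (simp_all add: ac_simps)
    from this[of k] have "(\<Prod>i=1..k. v (y i)) = (\<Prod>i=1..k. v (y (Suc i)))"
      using y uv(2)[of "y 1"] by simp
    then show ?thesis by (simp add: prod.distrib)
  qed
  then show ?thesis
    using assms(1-4) d unfolding cyclically_invariant_def by blast
qed

text \<open>
  Two successive refinements of the filter are used: the first makes \<open>\<pi>n\<close> converge, the second
  \<open>\<pi>n \<otimes> \<pi>n\<close>, regarded as couplings of \<open>\<pi>n\<close> with itself. Almost every pair under \<open>\<pi> \<otimes> \<pi>\<close> has all its
  coordinates in the supports of \<open>\<mu>\<close> and \<open>\<nu>\<close>; so the pair and its exchange consist of points of the support
  of \<open>R\<close>, where \<open>rn n / \<alpha> n\<close> converges.
\<close>

lemma cyclically_invariant_subsequential_limit: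
  fixes \<mu>n :: "nat \<Rightarrow> 'a::polish_space measure" and \<nu>n :: "nat \<Rightarrow> 'b::polish_space measure"
    and rn :: "nat \<Rightarrow> 'a \<times> 'b \<Rightarrow> real" and r :: "'a \<times> 'b \<Rightarrow> real"
  assumes F: "F \<le> sequentially" "F \<noteq> bot"
    and cyc: "\<And>n. n \<ge> 1 \<Longrightarrow> cyclically_invariant (\<mu>n n) (\<nu>n n) (\<pi>n n) (Rn n)"
    and \<mu>: "\<mu> \<in> borel_probs" "weakly_converges \<mu>n \<mu>"
    and \<nu>: "\<nu> \<in> borel_probs" "weakly_converges \<nu>n \<nu>"
    and R: "R \<in> borel_probs" and R_ac: "mutually_ac R (\<mu> \<Otimes>\<^sub>M \<nu>)"
    and rn: "\<And>n. n \<ge> 1 \<Longrightarrow> positive_density (Rn n) (\<mu>n n \<Otimes>\<^sub>M \<nu>n n) (rn n)"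
    and r: "positive_density R (\<mu> \<Otimes>\<^sub>M \<nu>) r"
    and \<alpha>: "\<And>n. n \<ge> 1 \<Longrightarrow> \<alpha> n > 0"
    and lim: "\<And>z. z \<in> spt R \<Longrightarrow>
      ((\<lambda>p. rn (fst p) (snd p) / \<alpha> (fst p)) \<longlongrightarrow> r z) (sequentially \<times>\<^sub>F nhds z)"
  obtains G \<pi> where "G \<le> F" "G \<noteq> bot" "\<pi> \<in> couplings \<mu> \<nu>" "weak_limit \<pi>n \<pi> G"
    "mutually_ac \<pi> (\<mu> \<Otimes>\<^sub>M \<nu>)" "product_density \<pi> R"
proof -
  have \<pi>n: "\<pi>n n \<in> couplings (\<mu>n n) (\<nu>n n)" if "n \<ge> 1" for n
    using cyc[OF that] by (simp add: cyclically_invariant_def)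
  have ev1: "\<forall>\<^sub>F n in H. n \<ge> 1" if "H \<le> sequentially" for H :: "nat filter"
    by (rule filter_leD[OF that eventually_ge_at_top])
  have couplings_F: "\<forall>\<^sub>F n in F. \<pi>n n \<in> couplings (\<mu>n n) (\<nu>n n)"
    using ev1[OF F(1)] by eventually_elim (rule \<pi>n)
  have marginals_F: "weak_limit \<mu>n \<mu> F" "weak_limit \<nu>n \<nu> F"
    using \<mu>(2) \<nu>(2) F(1) by (auto simp: weakly_converges_iff intro: weak_limit_mono)
  obtain H \<pi> where H: "H \<le> F" "H \<noteq> bot" and \<pi>: "\<pi> \<in> couplings \<mu> \<nu>" and \<pi>H: "weak_limit \<pi>n \<pi> H"
    by (rule coupling_limit[OF F(2) \<mu>(1) marginals_F(1) \<nu>(1) marginals_F(2) couplings_F])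
  note \<pi>b = couplingsD(1)[OF \<pi>]
  have \<pi>nb: "\<pi>n n \<in> borel_probs" if "n \<ge> 1" for n using \<pi>n[OF that] by (rule couplingsD)
  have H_seq: "H \<le> sequentially" using H(1) F(1) by (rule order_trans)
  have "\<forall>\<^sub>F n in H. \<pi>n n \<Otimes>\<^sub>M \<pi>n n \<in> couplings (\<pi>n n) (\<pi>n n)"
    using ev1[OF H_seq] by eventually_elim (intro pair_measure_in_couplings \<pi>nb)
  then obtain G Q where G: "G \<le> H" "G \<noteq> bot" and Q: "Q \<in> couplings \<pi> \<pi>"
    and QG: "weak_limit (\<lambda>n. \<pi>n n \<Otimes>\<^sub>M \<pi>n n) Q G"
    by (rule coupling_limit[OF H(2) \<pi>b \<pi>H \<pi>b \<pi>H])
  have G_seq: "G \<le> sequentially" using G(1) H_seq by (rule order_trans)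
  have \<pi>G: "weak_limit \<pi>n \<pi> G" by (rule weak_limit_mono[OF \<pi>H G(1)])
  have \<pi>nbG: "\<forall>\<^sub>F n in G. \<pi>n n \<in> borel_probs"
    using ev1[OF G_seq] by eventually_elim (rule \<pi>nb)
  have Q_eq: "Q = \<pi> \<Otimes>\<^sub>M \<pi>"
    by (rule weak_limit_coupling_of_self[OF G(2) \<pi>b \<pi>G \<pi>nbG couplingsD(1)[OF Q] QG])
  have Qb: "\<pi> \<Otimes>\<^sub>M \<pi> \<in> borel_probs" by (rule pair_measure_in_borel_probs[OF \<pi>b \<pi>b])
  have QnbG: "\<forall>\<^sub>F n in G. \<pi>n n \<Otimes>\<^sub>M \<pi>n n \<in> borel_probs"
    using \<pi>nbG by eventually_elim (intro pair_measure_in_borel_probs)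
  have r': "r \<in> borel_measurable borel" "\<And>z. 0 < r z" using r by (auto simp: positive_density_def)
  have rn': "rn n \<in> borel_measurable borel" "\<And>z. 0 < rn n z" if "n \<ge> 1" for n
    using rn[OF that] by (auto simp: positive_density_def)
  have w_le: "\<bar>exchange_weight (rn n) p\<bar> \<le> 1" if "n \<ge> 1" for n p
    using exchange_weight_pos[of "rn n" p] exchange_weight_le_1[of "rn n" p] rn'(2)[OF that] by (simp add: less_imp_le)
  have inv_n: "(\<integral>p. f (exchange p) * exchange_weight (rn n) p \<partial>(\<pi>n n \<Otimes>\<^sub>M \<pi>n n))
      = (\<integral>p. f p * exchange_weight (rn n) p \<partial>(\<pi>n n \<Otimes>\<^sub>M \<pi>n n))"
    if n: "n \<ge> 1" and f: "f \<in> borel_measurable borel" for n and f :: "('a \<times> 'b) \<times> ('a \<times> 'b) \<Rightarrow> real"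
  proof -
    obtain g where g: "positive_density (\<pi>n n) (Rn n) g"
      and cyc_g: "\<And>(k::nat) (x :: nat \<Rightarrow> 'a) (y :: nat \<Rightarrow> 'b). y (Suc k) = y 1 \<Longrightarrow>
        (\<Prod>i=1..k. g (x i, y i)) = (\<Prod>i=1..k. g (x i, y (Suc i)))"
      using cyc[OF n] unfolding cyclically_invariant_def by blast
    note \<mu>\<nu>n = couplings_marginal_borel_probs[OF \<pi>n[OF n]]
    show ?thesis
      by (rule exchange_weight_integral_invariant[OF \<mu>\<nu>n \<pi>nb[OF n]
          positive_density_trans[OF pair_measure_in_borel_probs[OF \<mu>\<nu>n] rn[OF n] g] rn'[OF n]
          cyclic_identity_exchange[of g, OF cyc_g] f])
  qed
  have in_spt: "AE z in \<pi>. fst z \<in> spt \<mu> \<and> snd z \<in> spt \<nu>"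
  proof -
    have "AE z in \<pi>. fst z \<in> spt \<mu>"
      by (rule AE_distrD[OF measurable_fst_snd_borel(1)[OF borel_probsD(2)[OF \<pi>b]]])
        (subst couplingsD(2)[OF \<pi>], rule AE_in_spt[OF \<mu>(1)])
    moreover have "AE z in \<pi>. snd z \<in> spt \<nu>"
      by (rule AE_distrD[OF measurable_fst_snd_borel(2)[OF borel_probsD(2)[OF \<pi>b]]])
        (subst couplingsD(3)[OF \<pi>], rule AE_in_spt[OF \<nu>(1)])
    ultimately show ?thesis by eventually_elim simp
  qed
  have w_lim: "AE p in \<pi> \<Otimes>\<^sub>M \<pi>.
    ((\<lambda>x. exchange_weight (rn (fst x)) (snd x)) \<longlongrightarrow> exchange_weight r p) (sequentially \<times>\<^sub>F nhds p)"
  proof -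
    note \<pi>\<pi> = pair_measure_in_couplings[OF \<pi>b \<pi>b]
    have "AE p in \<pi> \<Otimes>\<^sub>M \<pi>. fst (fst p) \<in> spt \<mu> \<and> snd (fst p) \<in> spt \<nu>"
      by (rule AE_distrD[OF measurable_fst_snd_borel(1)[OF borel_probsD(2)[OF Qb]]])
        (subst couplingsD(2)[OF \<pi>\<pi>], rule in_spt)
    moreover have "AE p in \<pi> \<Otimes>\<^sub>M \<pi>. fst (snd p) \<in> spt \<mu> \<and> snd (snd p) \<in> spt \<nu>"
      by (rule AE_distrD[OF measurable_fst_snd_borel(2)[OF borel_probsD(2)[OF Qb]]])
        (subst couplingsD(3)[OF \<pi>\<pi>], rule in_spt)
    ultimately show ?thesis
    proof eventually_elim
      case (elim p)
      \<comment> \<open>The weight does not see the normalising constants.\<close>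
      have "((\<lambda>x. exchange_weight (\<lambda>z. rn (fst x) z / \<alpha> (fst x)) (snd x)) \<longlongrightarrow> exchange_weight r p)
          (sequentially \<times>\<^sub>F nhds p)"
      proof (rule exchange_weight_tendsto[where rn="\<lambda>n z. rn n z / \<alpha> n", OF r'(2)])
        fix z assume "z \<in> {fst p, snd p, fst (exchange p), snd (exchange p)}"
        then have "z \<in> spt R"
          using elim by (intro spt_product[OF \<mu>(1) \<nu>(1) R R_ac]) (auto simp: exchange_def)
        then show "((\<lambda>x. rn (fst x) (snd x) / \<alpha> (fst x)) \<longlongrightarrow> r z) (sequentially \<times>\<^sub>F nhds z)"
          by (rule lim)
      qed
      moreover have "\<forall>\<^sub>F x in sequentially \<times>\<^sub>F nhds p. 1 \<le> fst x"
        by (rule filterlim_fst[unfolded filterlim_iff, rule_format]) (rule eventually_ge_at_top)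
      then have "\<forall>\<^sub>F x in sequentially \<times>\<^sub>F nhds p.
          exchange_weight (\<lambda>z. rn (fst x) z / \<alpha> (fst x)) (snd x) = exchange_weight (rn (fst x)) (snd x)"
        by eventually_elim (use \<alpha> in \<open>force simp: exchange_weight_scale\<close>)
      ultimately show ?case by (rule Lim_transform_eventually)
    qed
  qed
  have inv: "(\<integral>p. f (exchange p) * exchange_weight r p \<partial>(\<pi> \<Otimes>\<^sub>M \<pi>)) = (\<integral>p. f p * exchange_weight r p \<partial>(\<pi> \<Otimes>\<^sub>M \<pi>))"
    if f: "continuous_on UNIV f" "\<And>p. 0 \<le> f p" "\<And>p. f p \<le> 1" for f :: "('a \<times> 'b) \<times> ('a \<times> 'b) \<Rightarrow> real"
  proof -
    have lim_f: "((\<lambda>n. \<integral>p. f' p * exchange_weight (rn n) p \<partial>(\<pi>n n \<Otimes>\<^sub>M \<pi>n n))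
        \<longlongrightarrow> (\<integral>p. f' p * exchange_weight r p \<partial>(\<pi> \<Otimes>\<^sub>M \<pi>))) G"
      if f': "continuous_on UNIV f'" "\<And>p. 0 \<le> f' p" "\<And>p. f' p \<le> 1" for f' :: "('a \<times> 'b) \<times> ('a \<times> 'b) \<Rightarrow> real"
    proof (rule integral_tendsto_continuous_convergence[OF G_seq Qb QG[unfolded Q_eq] QnbG, where B=1])
      note f'_meas = borel_measurable_continuous_onI[OF f'(1)]
      show "(\<lambda>p. f' p * exchange_weight (rn n) p) \<in> borel_measurable borel" if "n \<ge> 1" for n
        by (rule borel_measurable_times[OF f'_meas measurable_exchange_weight[OF rn'(1)[OF that]]])
      show "\<bar>f' p * exchange_weight (rn n) p\<bar> \<le> 1" if "n \<ge> 1" for n p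
        using mult_mono[of "\<bar>f' p\<bar>" 1 "\<bar>exchange_weight (rn n) p\<bar>" 1] f'(2,3)[of p] w_le[OF that, of p]
        by (simp add: abs_mult)
      show "(\<lambda>p. f' p * exchange_weight r p) \<in> borel_measurable borel"
        by (rule borel_measurable_times[OF f'_meas measurable_exchange_weight[OF r'(1)]])
      show "AE p in \<pi> \<Otimes>\<^sub>M \<pi>. ((\<lambda>x. f' (snd x) * exchange_weight (rn (fst x)) (snd x))
          \<longlongrightarrow> f' p * exchange_weight r p) (sequentially \<times>\<^sub>F nhds p)"
        using w_lim
      proof eventually_elim
        case (elim p)
        have "isCont f' p" using f'(1) continuous_on_eq_continuous_at[OF open_UNIV] by blast
        then have "((\<lambda>x. f' (snd x)) \<longlongrightarrow> f' p) (sequentially \<times>\<^sub>F nhds p)"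
          by (rule isCont_tendsto_compose[OF _ filterlim_snd])
        then show ?case by (rule tendsto_mult[OF _ elim])
      qed
    qed
    have fe: "continuous_on UNIV (\<lambda>p. f (exchange p))"
      by (rule continuous_on_compose2[OF f(1) continuous_exchange]) simp
    have "((\<lambda>n. \<integral>p. f (exchange p) * exchange_weight (rn n) p \<partial>(\<pi>n n \<Otimes>\<^sub>M \<pi>n n))
        \<longlongrightarrow> (\<integral>p. f (exchange p) * exchange_weight r p \<partial>(\<pi> \<Otimes>\<^sub>M \<pi>))) G"
      by (rule lim_f[OF fe]) (simp_all add: f(2,3))
    moreover have "\<forall>\<^sub>F n in G. (\<integral>p. f (exchange p) * exchange_weight (rn n) p \<partial>(\<pi>n n \<Otimes>\<^sub>M \<pi>n n))
        = (\<integral>p. f p * exchange_weight (rn n) p \<partial>(\<pi>n n \<Otimes>\<^sub>M \<pi>n n))"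
      using ev1[OF G_seq] by eventually_elim (rule inv_n[OF _ borel_measurable_continuous_onI[OF f(1)]])
    ultimately have "((\<lambda>n. \<integral>p. f p * exchange_weight (rn n) p \<partial>(\<pi>n n \<Otimes>\<^sub>M \<pi>n n))
        \<longlongrightarrow> (\<integral>p. f (exchange p) * exchange_weight r p \<partial>(\<pi> \<Otimes>\<^sub>M \<pi>))) G"
      by (rule Lim_transform_eventually)
    then show ?thesis by (rule tendsto_unique[OF G(2) _ lim_f[OF f]])
  qed
  have "mutually_ac \<pi> (\<mu> \<Otimes>\<^sub>M \<nu>)" "product_density \<pi> R"
    by (rule product_density_of_exchange_invariance[OF \<pi> r inv]; assumption)+
  moreover have "G \<le> F" using G(1) H(1) by (rule order_trans)
  ultimately show thesis using that G(2) \<pi> \<pi>G by blast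
qed

theorem theorem2p5:
  fixes \<mu>n :: "nat \<Rightarrow> 'a::polish_space measure" and \<mu> :: "'a measure"
    and \<nu>n :: "nat \<Rightarrow> 'b::polish_space measure" and \<nu> :: "'b measure"
    and Rn \<pi>n :: "nat \<Rightarrow> ('a \<times> 'b) measure" and R :: "('a \<times> 'b) measure"
    and rn :: "nat \<Rightarrow> 'a \<times> 'b \<Rightarrow> real" and r :: "'a \<times> 'b \<Rightarrow> real"
    and \<alpha> :: "nat \<Rightarrow> real"
  assumes diff_X: "differentiation_of_measures (dist :: 'a \<Rightarrow> 'a \<Rightarrow> real)"
    and diff_XY: "differentiation_of_measures (max_dist :: 'a \<times> 'b \<Rightarrow> 'a \<times> 'b \<Rightarrow> real)"
    and \<mu>n: "\<And>n. n \<ge> 1 \<Longrightarrow> \<mu>n n \<in> borel_probs"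
    and \<nu>n: "\<And>n. n \<ge> 1 \<Longrightarrow> \<nu>n n \<in> borel_probs"
    and Rn: "\<And>n. n \<ge> 1 \<Longrightarrow> Rn n \<in> borel_probs"
    and \<pi>n: "\<And>n. n \<ge> 1 \<Longrightarrow> \<pi>n n \<in> couplings (\<mu>n n) (\<nu>n n)"
    and cyc: "\<And>n. n \<ge> 1 \<Longrightarrow> cyclically_invariant (\<mu>n n) (\<nu>n n) (\<pi>n n) (Rn n)"
    and \<mu>: "\<mu> \<in> borel_probs" "weakly_converges \<mu>n \<mu>"
    and \<nu>: "\<nu> \<in> borel_probs" "weakly_converges \<nu>n \<nu>"
    and R: "R \<in> borel_probs" "weakly_converges Rn R"
    and R_ac: "mutually_ac R (\<mu> \<Otimes>\<^sub>M \<nu>)"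
    and rn: "\<And>n. n \<ge> 1 \<Longrightarrow> positive_density (Rn n) (\<mu>n n \<Otimes>\<^sub>M \<nu>n n) (rn n)"
    and r: "positive_density R (\<mu> \<Otimes>\<^sub>M \<nu>) r"
    and \<alpha>: "\<And>n. n \<ge> 1 \<Longrightarrow> \<alpha> n > 0"
    and asymp: "\<And>z. z \<in> spt R \<Longrightarrow>
      \<exists>\<phi> :: 'a \<times> 'b \<Rightarrow> nat \<Rightarrow> real.
        (\<forall>z'. \<forall>n\<ge>1. rn n z' = (1 + \<phi> z' n) * \<alpha> n * r z) \<and>
        (\<forall>\<epsilon>>0. \<exists>\<delta>>0. \<forall>z'. \<forall>n\<ge>1. max_dist z' z + 1 / real n < \<delta> \<longrightarrow> \<bar>\<phi> z' n\<bar> < \<epsilon>)"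
  shows "\<exists>\<pi> \<in> couplings \<mu> \<nu>.
    weakly_converges \<pi>n \<pi> \<and> mutually_ac \<pi> R \<and> cyclically_invariant \<mu> \<nu> \<pi> R"
proof -
  have r_pos: "0 < r z" for z using r unfolding positive_density_def by blast
  have lim: "((\<lambda>p. rn (fst p) (snd p) / \<alpha> (fst p)) \<longlongrightarrow> r z) (sequentially \<times>\<^sub>F nhds z)"
    if z: "z \<in> spt R" for z
  proof -
    obtain \<phi> :: "'a \<times> 'b \<Rightarrow> nat \<Rightarrow> real" where \<phi>: "\<forall>z'. \<forall>n\<ge>1. rn n z' = (1 + \<phi> z' n) * \<alpha> n * r z"
      "\<forall>\<epsilon>>0. \<exists>\<delta>>0. \<forall>z'. \<forall>n\<ge>1. max_dist z' z + 1 / real n < \<delta> \<longrightarrow> \<bar>\<phi> z' n\<bar> < \<epsilon>"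
      using asymp[OF z] by blast
    show ?thesis
      by (rule relative_error_tendsto[where \<phi>=\<phi>, OF r_pos \<alpha>]) (use \<phi> in auto)
  qed
  note sub = cyclically_invariant_subsequential_limit[where rn=rn and \<alpha>=\<alpha>, OF _ _ cyc \<mu> \<nu> R(1) R_ac rn r \<alpha> lim]
  obtain G \<pi> where \<pi>: "\<pi> \<in> couplings \<mu> \<nu>" "mutually_ac \<pi> (\<mu> \<Otimes>\<^sub>M \<nu>)" "product_density \<pi> R"
    using sub[OF order_refl sequentially_bot] by blast
  have \<pi>_R: "mutually_ac \<pi> R" using mutually_ac_trans[OF \<pi>(2) mutually_ac_sym[OF R_ac]] .
  have "weakly_converges \<pi>n \<pi>"
    unfolding weakly_converges_iff weak_limit_def
  proof (intro allI impI, rule ccontr)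
    fix f :: "'a \<times> 'b \<Rightarrow> real"
    assume f: "continuous_on UNIV f \<and> bounded (range f)"
      and "\<not> (\<lambda>n. \<integral>x. f x \<partial>\<pi>n n) \<longlonglongrightarrow> (\<integral>x. f x \<partial>\<pi>)"
    then obtain e where e: "e > 0"
      and not: "\<not> (\<forall>\<^sub>F n in sequentially. dist (\<integral>x. f x \<partial>\<pi>n n) (\<integral>x. f x \<partial>\<pi>) < e)"
      unfolding tendsto_iff by blast
    \<comment> \<open>Along the indices at which the integrals stay away from the limit there is again a limit point.\<close>
    define B where "B = {n. \<not> dist (\<integral>x. f x \<partial>\<pi>n n) (\<integral>x. f x \<partial>\<pi>) < e}"
    define F where "F = inf sequentially (principal B)"
    have "F \<noteq> bot"
      using not by (simp add: F_def B_def trivial_limit_def eventually_inf_principal)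
    moreover have "F \<le> sequentially" by (simp add: F_def)
    ultimately obtain G \<pi>' where G: "G \<le> F" "G \<noteq> bot"
      and \<pi>': "\<pi>' \<in> couplings \<mu> \<nu>" "weak_limit \<pi>n \<pi>' G" "product_density \<pi>' R"
      using sub by blast
    have "\<pi>' = \<pi>" by (rule coupling_product_density_unique[OF \<pi>(1) \<pi>'(1) R(1) \<pi>(3) \<pi>'(3)])
    then have "((\<lambda>n. \<integral>x. f x \<partial>\<pi>n n) \<longlongrightarrow> (\<integral>x. f x \<partial>\<pi>)) G"
      using \<pi>'(2) f unfolding weak_limit_def by blast
    then have "\<forall>\<^sub>F n in G. dist (\<integral>x. f x \<partial>\<pi>n n) (\<integral>x. f x \<partial>\<pi>) < e" using e by (rule tendstoD)
    moreover have "\<forall>\<^sub>F n in G. n \<in> B"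
      by (rule filter_leD[OF G(1)]) (simp add: F_def eventually_inf_principal)
    ultimately have "\<forall>\<^sub>F n in G. False" by eventually_elim (simp add: B_def)
    then show False using G(2) by (simp add: trivial_limit_def)
  qed
  moreover have "cyclically_invariant \<mu> \<nu> \<pi> R"
    by (rule product_density_cyclically_invariant[OF \<pi>(1) R(1) \<pi>_R R_ac \<pi>(3)])
  ultimately show ?thesis using \<pi>(1) \<pi>_R by blast
qed

end
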